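(* Let $X^{sk}$ be a generic skew symmetric $2n\times 2n$ matrix. Then the apolar ideal $\mathrm{Ann}(Pf(X^{sk}))\subset S^{sk}$ equals the ideal $(W)$ of $S^{sk}$ generated by $W$; in particular it is generated in degree 2.
   Context: Let $\mathsf k$ be a field of characteristic zero or of characteristic $p>2$. Let $X^{sk}=(x_{ij})$ and $Y^{sk}=(y_{ij})$ be $2n\times2n$ generic skew symmetric matrices ($x_{ij}=-x_{ji}$, $y_{ij}=-y_{ji}$, zero diagonal) of indeterminates, the $x_{ij}$ (resp. $y_{ij}$) with $i<j$ being independent variables; $R^{sk}=\mathsf k[x_{ij}: i<j]$, $S^{sk}=\mathsf k[y_{ij}: i<j]$, with the standard grading. $S^{sk}$ acts on $R^{sk}$ by contraction: $\prod y_{ij}^{\alpha_{ij}}\circ\prod x_{ij}^{\beta_{ij}}=\prod x_{ij}^{\beta_{ij}-\alpha_{ij}}$ (products over $i<j$) if $\alpha_{ij}\le\beta_{ij}$ for all $i<j$, and $0$ otherwise, extended $\mathsf k$-bilinearly. $\mathrm{Ann}(F)=\{\Phi\in S^{sk}:\Phi\circ F=0\}$. The Pfaffian is $Pf(X^{sk})=\sum_{\sigma\in F_{2n}}\mathrm{sgn}(\sigma)\,x_{\sigma(1)\sigma(2)}x_{\sigma(3)\sigma(4)}\cdots x_{\sigma(2n-1)\sigma(2n)}$, where $F_{2n}$ is the set of permutations $\sigma$ of $\{1,\dots,2n\}$ with $\sigma(1)<\sigma(3)<\dots<\sigma(2n-1)$ and $\sigma(2i-1)<\sigma(2i)$ for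 $1\le i\le n$. $W\subset S^{sk}_2$ is the $\mathsf k$-span of: (a) the squares $y_{ij}^2$ of the entries of $Y^{sk}$; (b) the products of each entry of $Y^{sk}$ with another entry in the same row or column of $Y^{sk}$, i.e. $y_{ij}y_{kl}$ with $\{i,j\}\ne\{k,l\}$ and $\{i,j\}\cap\{k,l\}\neq\emptyset$; (c) for all $i_1<i_2<i_3<i_4$, the binomials $y_{i_1i_2}y_{i_3i_4}+y_{i_1i_3}y_{i_2i_4}$, $y_{i_1i_2}y_{i_3i_4}-y_{i_1i_4}y_{i_2i_3}$ and $y_{i_1i_3}y_{i_2i_4}+y_{i_1i_4}y_{i_2i_3}$. *)

theory Defs
  imports Complex_Main "HOL-Library.Poly_Mapping" "HOL-Combinatorics.Permutations" "HOL-Algebra.Ideal"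
begin

text \<open>
  A monomial is a finitely supported exponent function on variables, and a polynomial is a
  finitely supported coefficient function on monomials. The variable \<^term>\<open>(i, j)\<close> stands for
  $x_{ij}$ in $R^{sk}$ and for $y_{ij}$ in $S^{sk}$; both rings are represented by the same
  carrier \<open>skew_ring n\<close>, which restricts the variables to $1 \le i < j \le 2n$.
\<close>

type_synonym skew_monom = "(nat \<times> nat) \<Rightarrow>\<^sub>0 nat"
type_synonym 'k skew_poly = "skew_monom \<Rightarrow>\<^sub>0 'k"

definition skew_vars :: "nat \<Rightarrow> (nat \<times> nat) set" where
  "skew_vars n = {(i, j). 1 \<le> i \<and> i < j \<and> j \<le> 2 * n}"

definition skew_polys :: "nat \<Rightarrow> 'k::field skew_poly set" where
  "skew_polys n = {f. \<forall>m \<in> Poly_Mapping.keys f. Poly_Mapping.keys m \<subseteq> skew_vars n}"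

definition skew_ring :: "nat \<Rightarrow> 'k::field skew_poly ring" where
  "skew_ring n = \<lparr>carrier = skew_polys n, mult = (*), one = 1, zero = 0, add = (+)\<rparr>"

definition monom_degree :: "skew_monom \<Rightarrow> nat" where
  "monom_degree m = (\<Sum>v \<in> Poly_Mapping.keys m. Poly_Mapping.lookup m v)"

definition homogeneous_part :: "nat \<Rightarrow> nat \<Rightarrow> 'k::field skew_poly set" where
  "homogeneous_part n d = {f \<in> skew_polys n. \<forall>m \<in> Poly_Mapping.keys f. monom_degree m = d}"

definition var :: "nat \<times> nat \<Rightarrow> 'k::field skew_poly" where
  "var v = Poly_Mapping.single (Poly_Mapping.single v 1) 1"

definition generic_skew :: "nat \<Rightarrow> nat \<Rightarrow> 'k::field skew_poly" where
  "generic_skew i j = (if i < j then var (i, j) else if j < i then - var (j, i) else 0)"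

definition pfaffian_perms :: "nat \<Rightarrow> (nat \<Rightarrow> nat) set" where
  "pfaffian_perms n = {\<sigma>. \<sigma> permutes {1..2 * n}
     \<and> (\<forall>i \<in> {1..n}. \<forall>j \<in> {1..n}. i < j \<longrightarrow> \<sigma> (2 * i - 1) < \<sigma> (2 * j - 1))
     \<and> (\<forall>i \<in> {1..n}. \<sigma> (2 * i - 1) < \<sigma> (2 * i))}"

definition pfaffian :: "nat \<Rightarrow> (nat \<Rightarrow> nat \<Rightarrow> 'a::comm_ring_1) \<Rightarrow> 'a" where
  "pfaffian n A =
     (\<Sum>\<sigma> \<in> pfaffian_perms n. of_int (sign \<sigma>) * (\<Prod>i = 1..n. A (\<sigma> (2 * i - 1)) (\<sigma> (2 * i))))"

text \<open>
  The library order on \<^typ>\<open>skew_monom\<close> is lexicographic, so divisibility of monomials is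
  spelled out pointwise. Subtraction of monomials is pointwise.
\<close>

definition contract_monom :: "skew_monom \<Rightarrow> skew_monom \<Rightarrow> 'k::field skew_poly" where
  "contract_monom a b =
     (if \<forall>v. Poly_Mapping.lookup a v \<le> Poly_Mapping.lookup b v
      then Poly_Mapping.single (b - a) 1 else 0)"

definition scale :: "'k::field \<Rightarrow> 'k skew_poly \<Rightarrow> 'k skew_poly" where
  "scale c f = Poly_Mapping.single 0 c * f"

interpretation skew: vector_space "scale :: 'k::field \<Rightarrow> 'k skew_poly \<Rightarrow> 'k skew_poly"
  by standard
    (simp_all add: scale_def algebra_simps single_add mult_single flip: mult.assoc)

definition contract :: "'k::field skew_poly \<Rightarrow> 'k skew_poly \<Rightarrow> 'k skew_poly" where
  "contract \<Phi> F = (\<Sum>a \<in> Poly_Mapping.keys \<Phi>. \<Sum>b \<in> Poly_Mapping.keys F.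
     scale (Poly_Mapping.lookup \<Phi> a * Poly_Mapping.lookup F b) (contract_monom a b))"

definition Ann :: "nat \<Rightarrow> 'k::field skew_poly \<Rightarrow> 'k skew_poly set" where
  "Ann n F = {\<Phi> \<in> carrier (skew_ring n). contract \<Phi> F = 0}"

definition W_squares :: "nat \<Rightarrow> 'k::field skew_poly set" where
  "W_squares n = {(generic_skew i j)\<^sup>2 | i j. i \<in> {1..2 * n} \<and> j \<in> {1..2 * n}}"

definition W_products :: "nat \<Rightarrow> 'k::field skew_poly set" where
  "W_products n = {generic_skew i j * generic_skew k l | i j k l.
     i \<in> {1..2 * n} \<and> j \<in> {1..2 * n} \<and> k \<in> {1..2 * n} \<and> l \<in> {1..2 * n}
     \<and> {i, j} \<noteq> {k, l} \<and> {i, j} \<inter> {k, l} \<noteq> {}}"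

definition W_binomials :: "nat \<Rightarrow> 'k::field skew_poly set" where
  "W_binomials n =
     (\<Union>(a, b, c, d) \<in> {(a, b, c, d). 1 \<le> a \<and> a < b \<and> b < c \<and> c < d \<and> d \<le> 2 * n}.
       {generic_skew a b * generic_skew c d + generic_skew a c * generic_skew b d,
        generic_skew a b * generic_skew c d - generic_skew a d * generic_skew b c,
        generic_skew a c * generic_skew b d + generic_skew a d * generic_skew b c})"

definition W :: "nat \<Rightarrow> 'k::field skew_poly set" where
  "W n = skew.span (W_squares n \<union> W_products n \<union> W_binomials n)"

definition generated_in_degree :: "nat \<Rightarrow> nat \<Rightarrow> 'k::field skew_poly set \<Rightarrow> bool" where
  "generated_in_degree n d I \<longleftrightarrow>
     (\<exists>G \<subseteq> homogeneous_part n d. I = Idl\<^bsub>skew_ring n\<^esub> G)"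

lemma skew_polys_zero [simp]: "0 \<in> skew_polys n"
  and skew_polys_one [simp]: "1 \<in> skew_polys n"
  by (auto simp: skew_polys_def)

lemma skew_polys_uminus: "f \<in> skew_polys n \<Longrightarrow> - f \<in> skew_polys n"
  by (auto simp: skew_polys_def in_keys_iff)

lemma skew_polys_add: "f \<in> skew_polys n \<Longrightarrow> g \<in> skew_polys n \<Longrightarrow> f + g \<in> skew_polys n"
  using keys_add[of f g] unfolding skew_polys_def by blast

lemma skew_polys_mult:
  assumes "f \<in> skew_polys n" "g \<in> skew_polys n"
  shows "f * g \<in> skew_polys n"
  unfolding skew_polys_def
proof (intro CollectI ballI)
  fix m assume "m \<in> Poly_Mapping.keys (f * g)"
  then obtain a b where "m = a + b" "a \<in> Poly_Mapping.keys f" "b \<in> Poly_Mapping.keys g"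
    using keys_mult[of f g] by blast
  then show "Poly_Mapping.keys m \<subseteq> skew_vars n"
    using assms keys_add[of a b] unfolding skew_polys_def by blast
qed

lemma cring_skew_ring: "cring (skew_ring n :: 'k::field skew_poly ring)"
proof (rule cringI)
  show "abelian_group (skew_ring n :: 'k skew_poly ring)"
  proof (rule abelian_groupI)
    fix x :: "'k skew_poly" assume "x \<in> carrier (skew_ring n)"
    then show "\<exists>y \<in> carrier (skew_ring n). y \<oplus>\<^bsub>skew_ring n\<^esub> x = \<zero>\<^bsub>skew_ring n\<^esub>"
      by (auto simp: skew_ring_def intro!: bexI[of _ "- x"] skew_polys_uminus)
  qed (auto simp: skew_ring_def skew_polys_add ac_simps)
  show "Group.comm_monoid (skew_ring n :: 'k skew_poly ring)"
    by (rule comm_monoidI) (auto simp: skew_ring_def skew_polys_mult ac_simps)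
qed (auto simp: skew_ring_def algebra_simps)

lemma homogeneous_part_subspace: "skew.subspace (homogeneous_part n d :: 'k::field skew_poly set)"
proof (rule skew.subspaceI)
  show "(0::'k skew_poly) \<in> homogeneous_part n d"
    by (simp add: homogeneous_part_def)
  show "x + y \<in> homogeneous_part n d"
    if "x \<in> homogeneous_part n d" "y \<in> homogeneous_part n d" for x y :: "'k skew_poly"
    using that keys_add[of x y] skew_polys_add unfolding homogeneous_part_def by blast
  show "scale c x \<in> homogeneous_part n d"
    if "x \<in> homogeneous_part n d" for c and x :: "'k skew_poly"
  proof -
    have "Poly_Mapping.keys (scale c x) \<subseteq> Poly_Mapping.keys x"
      using keys_mult[of "Poly_Mapping.single 0 c" x]
      by (auto simp: scale_def split: if_splits)
    then show ?thesis
      using that unfolding homogeneous_part_def skew_polys_def by blast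
  qed
qed

lemma monom_degree_add: "monom_degree (a + b) = monom_degree a + monom_degree b"
  unfolding monom_degree_def
  by (rule setsum_keys_plus_distrib) simp_all

lemma homogeneous_part_mult:
  assumes "f \<in> homogeneous_part n d" "g \<in> homogeneous_part n e"
  shows "f * g \<in> homogeneous_part n (d + e)"
proof -
  have "monom_degree m = d + e" if "m \<in> Poly_Mapping.keys (f * g)" for m
    using that keys_mult[of f g] assms
    by (fastforce simp: homogeneous_part_def monom_degree_add)
  then show ?thesis
    using assms skew_polys_mult by (auto simp: homogeneous_part_def)
qed

lemma generic_skew_homogeneous:
  assumes "i \<in> {1..2 * n}" "j \<in> {1..2 * n}"
  shows "generic_skew i j \<in> homogeneous_part n 1"
  using assms
  by (auto simp: generic_skew_def homogeneous_part_def skew_polys_def var_def skew_vars_def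
      monom_degree_def skew_polys_uminus in_keys_iff lookup_single when_def split: if_splits)

lemma W_subset_degree_two: "(W n :: 'k::field skew_poly set) \<subseteq> homogeneous_part n 2"
  unfolding W_def
proof (rule skew.span_minimal[OF _ homogeneous_part_subspace], rule subsetI)
  have *: "(generic_skew i j * generic_skew k l :: 'k skew_poly) \<in> homogeneous_part n 2"
    if "i \<in> {1..2 * n}" "j \<in> {1..2 * n}" "k \<in> {1..2 * n}" "l \<in> {1..2 * n}" for i j k l
    using homogeneous_part_mult[OF generic_skew_homogeneous[OF that(1,2)]
        generic_skew_homogeneous[OF that(3,4)]]
    by (simp add: numeral_2_eq_2)
  fix f :: "'k skew_poly" assume "f \<in> W_squares n \<union> W_products n \<union> W_binomials n"
  then show "f \<in> homogeneous_part n 2"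
    by (auto simp: W_squares_def W_products_def W_binomials_def power2_eq_square
        intro!: * skew.subspace_add[OF homogeneous_part_subspace]
          skew.subspace_diff[OF homogeneous_part_subspace])
qed

end

theory Submission
  imports Defs
begin

text \<open>
  Modulo the ideal generated by \<^term>\<open>W n\<close>, the polynomial ring becomes the even part of an
  exterior algebra, with $y_{ij}$ in the role of $e_i \wedge e_j$: interchanging two adjacent letters
  of a product $y_{a_1 a_2} y_{a_3 a_4} \cdots$ changes its sign, and a repeated letter kills it. So
  every polynomial is congruent to a linear combination of the monomials $y_T$ obtained by listing an
  even set $T$ of indices in increasing order. The coefficient of the Pfaffian at a perfect matching
  has the same antisymmetry, so \<^term>\<open>W n\<close> annihilates it. The contraction $y_T \circ Pf$ is a
  nonzero combination of matchings of the complement of $T$, so these contractions are linearly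
  independent, and a combination of the $y_T$ in the annihilator is zero.
\<close>

section \<open>Reduction modulo the quadratic relations\<close>

text \<open>The antisymmetry of the Pfaffian is hidden by its definition: the sum runs over
  normalised permutations, and interchanging two letters usually leaves that set. Therefore
  \<open>pfaffian_term\<close> is taken for every permutation. It is invariant under the moves that
  permute the pairs and the entries of a pair, so it can be brought to normalised form, and distinct
  normalised permutations give distinct monomials. Hence the coefficient at a matching can be read
  off from any permutation that realises it, and one transposition compares two matchings. Signs
  modulo the ideal are never computed: only a scalar 1 or -1 is needed, both for reducing to normal
  form and for proving a pairing nonzero. That y_T contracts the Pfaffian to something nonzero is
  also obtained without an expansion: multiplied by the word of the complement of T, it becomes a
  word in all 2n letters, which modulo the ideal is, up to sign, the term of the identity. The
  inclusion of the ideal in the annihilator is thus an ingredient of the reverse inclusion.\<close>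

lemma carrier_skew_ring [simp]: "carrier (skew_ring n) = skew_polys n"
  by (simp add: skew_ring_def)

lemma W_subset_skew_polys: "W n \<subseteq> skew_polys n"
  using W_subset_degree_two by (auto simp: homogeneous_part_def)

lemma ideal_W: "ideal (Idl\<^bsub>skew_ring n\<^esub> (W n)) (skew_ring n :: 'k::field skew_poly ring)"
  by (rule ring.genideal_ideal[OF cring.axioms(1)[OF cring_skew_ring]])
    (simp add: W_subset_skew_polys)

abbreviation (input) W_ideal :: "nat \<Rightarrow> 'k::field skew_poly set" where
  "W_ideal n \<equiv> Idl\<^bsub>skew_ring n\<^esub> (W n)"

lemma W_ideal_W: "f \<in> W n \<Longrightarrow> f \<in> W_ideal n"
  using ring.genideal_self[OF cring.axioms(1)[OF cring_skew_ring], of "W n" n] W_subset_skew_polys[of n]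
  by auto

lemma W_ideal_zero [simp]: "0 \<in> W_ideal n"
  using additive_subgroup.zero_closed[OF ideal.axioms(1)[OF ideal_W, of n]]
  by (simp add: skew_ring_def)

lemma W_ideal_add: "f \<in> W_ideal n \<Longrightarrow> g \<in> W_ideal n \<Longrightarrow> f + g \<in> W_ideal n"
  using additive_subgroup.a_closed[OF ideal.axioms(1)[OF ideal_W, of n]]
  by (simp add: skew_ring_def)

lemma W_ideal_mult: "f \<in> W_ideal n \<Longrightarrow> g \<in> skew_polys n \<Longrightarrow> g * f \<in> W_ideal n"
  using ideal.I_l_closed[OF ideal_W, of f n g] by (simp add: skew_ring_def)

lemma W_ideal_uminus: "f \<in> W_ideal n \<Longrightarrow> - f \<in> W_ideal n"
  using W_ideal_mult[of f n "- 1"] by (simp add: skew_polys_uminus)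

lemma W_ideal_diff: "f \<in> W_ideal n \<Longrightarrow> g \<in> W_ideal n \<Longrightarrow> f - g \<in> W_ideal n"
  using W_ideal_add[of f n "- g"] W_ideal_uminus[of g n] by simp

lemma scale_skew_polys: "f \<in> skew_polys n \<Longrightarrow> scale c f \<in> skew_polys n"
  unfolding scale_def by (rule skew_polys_mult) (auto simp: skew_polys_def)

lemma W_ideal_scale: "f \<in> W_ideal n \<Longrightarrow> scale c f \<in> W_ideal n"
  unfolding scale_def by (rule W_ideal_mult) (auto simp: skew_polys_def)

section \<open>The quadratic relations for arbitrary indices\<close>

lemma generic_skew_swap: "generic_skew j i = - generic_skew i j"
  by (auto simp: generic_skew_def)

lemma generic_skew_same [simp]: "generic_skew i i = 0"
  by (simp add: generic_skew_def)

lemma generic_skew_skew_polys: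
  "i \<in> {1..2 * n} \<Longrightarrow> j \<in> {1..2 * n} \<Longrightarrow> generic_skew i j \<in> skew_polys n"
  using generic_skew_homogeneous by (auto simp: homogeneous_part_def)

text \<open>A repetition inside a factor makes the factor vanish. A repetition across the factors
  gives a square up to sign, if both factors have the same index set, and otherwise a product from
  \<open>W_products\<close>.\<close>

lemma prod_not_distinct_in_W_ideal:
  assumes "{a, b, c, d} \<subseteq> {1..2 * n}" "\<not> distinct [a, b, c, d]"
  shows "(generic_skew a b * generic_skew c d :: 'k::field skew_poly) \<in> W_ideal n"
proof -
  have gen: "f \<in> W_ideal n" if "f \<in> W_squares n \<union> W_products n" for f :: "'k skew_poly"
    using that by (intro W_ideal_W) (auto simp: W_def intro: skew.span_base)
  have sq: "(generic_skew a b)\<^sup>2 \<in> (W_ideal n :: 'k skew_poly set)"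
    using assms(1) by (intro gen) (auto simp: W_squares_def)
  consider "a = b \<or> c = d" | "c = a" "d = b" | "c = b" "d = a"
    | "{a, b} \<noteq> {c, d}" "{a, b} \<inter> {c, d} \<noteq> {}"
    using assms(2) by (auto simp: doubleton_eq_iff)
  then show ?thesis
  proof cases
    case 1
    then show ?thesis by auto
  next
    case 2
    then show ?thesis using sq by (simp add: power2_eq_square)
  next
    case 3
    then show ?thesis using W_ideal_uminus[OF sq]
      by (simp add: power2_eq_square generic_skew_swap[of b a])
  next
    case 4
    moreover have "a \<in> {1..2 * n}" "b \<in> {1..2 * n}" "c \<in> {1..2 * n}" "d \<in> {1..2 * n}"
      using assms(1) by blast+
    ultimately show ?thesis
      by (intro gen UnI2) (unfold W_products_def, blast)
  qed
qed

text \<open>The exterior relation for the two middle letters of the word \<open>a b c d\<close>. For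
  p < q < r < s the three binomials are, up to sign, this relation for the words
  \<open>p q r s\<close>, \<open>p q s r\<close> and \<open>p r s q\<close>; the other orders follow
  from skew symmetry.\<close>

lemma exchange_in_W_ideal:
  assumes "{a, b, c, d} \<subseteq> {1..2 * n}"
  shows "(generic_skew a b * generic_skew c d + generic_skew a c * generic_skew b d
    :: 'k::field skew_poly) \<in> W_ideal n"
proof (cases "distinct [a, b, c, d]")
  case False
  then have "\<not> distinct [a, c, b, d]" by auto
  then show ?thesis
    using False assms by (intro W_ideal_add prod_not_distinct_in_W_ideal) auto
next
  case True
  have sorted: "generic_skew p q * generic_skew r s + generic_skew p r * generic_skew q s
        \<in> (W_ideal n :: 'k skew_poly set)"
      "generic_skew p q * generic_skew r s - generic_skew p s * generic_skew q r
        \<in> (W_ideal n :: 'k skew_poly set)"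
      "generic_skew p r * generic_skew q s + generic_skew p s * generic_skew q r
        \<in> (W_ideal n :: 'k skew_poly set)"
    if "p \<in> {1..2 * n}" "s \<in> {1..2 * n}" "p < q" "q < r" "r < s" for p q r s
  proof -
    have "f \<in> W_ideal n" if "f \<in> W_binomials n" for f :: "'k skew_poly"
      using that by (intro W_ideal_W) (auto simp: W_def intro: skew.span_base)
    moreover have "(p, q, r, s) \<in> {(a, b, c, d). 1 \<le> a \<and> a < b \<and> b < c \<and> c < d \<and> d \<le> 2 * n}"
      using that by auto
    ultimately show "generic_skew p q * generic_skew r s + generic_skew p r * generic_skew q s
        \<in> (W_ideal n :: 'k skew_poly set)"
      "generic_skew p q * generic_skew r s - generic_skew p s * generic_skew q r
        \<in> (W_ideal n :: 'k skew_poly set)"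
      "generic_skew p r * generic_skew q s + generic_skew p s * generic_skew q r
        \<in> (W_ideal n :: 'k skew_poly set)"
      unfolding W_binomials_def by blast+
  qed
  \<comment> \<open>The expression does not change when \<open>b\<close> and \<open>c\<close> are
    exchanged, nor when \<open>a\<close> and \<open>d\<close> are exchanged (two sign changes in
    each product). So only the six interleavings of \<open>b < c\<close> with \<open>a < d\<close>
    remain.\<close>
  have wlog: "generic_skew a b * generic_skew c d + generic_skew a c * generic_skew b d
      \<in> (W_ideal n :: 'k skew_poly set)"
    if "{a, b, c, d} \<subseteq> {1..2 * n}" "distinct [a, b, c, d]" "b < c" "a < d" for a b c d
  proof -
    note u = W_ideal_uminus and order = that(2-4)
    consider "a < b" "c < d" | "a < b" "b < d" "d < c" | "a < b" "d < b"
      | "b < a" "c < d" "a < c" | "b < a" "c < d" "c < a" | "b < a" "d < c"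
      using order by force
    then show ?thesis
    proof cases
      case 1
      \<comment> \<open>The instantiations of \<open>sorted\<close> list the letters as smallest,
        largest, second, third, because its premises mention \<open>p\<close> and \<open>s\<close>
        first.\<close>
      then show ?thesis using sorted(1)[of a d b c] that by simp
    next
      case 2
      then show ?thesis using u[OF sorted(2)[of a c b d]] that
        by (simp add: generic_skew_swap[of c d] algebra_simps)
    next
      case 3
      then show ?thesis using u[OF sorted(3)[of a c d b]] that
        by (simp add: generic_skew_swap[of b d] generic_skew_swap[of c d] algebra_simps)
    next
      case 4
      then show ?thesis using u[OF sorted(2)[of b d a c]] that
        by (simp add: generic_skew_swap[of a b] algebra_simps)
    next
      case 5
      then show ?thesis using u[OF sorted(3)[of b d c a]] that
        by (simp add: generic_skew_swap[of a b] generic_skew_swap[of a c] algebra_simps)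
    next
      case 6
      then show ?thesis using sorted(1)[of b c a d] that
        by (simp add: generic_skew_swap[of a b] generic_skew_swap[of c d] algebra_simps)
    qed
  qed
  show ?thesis
  proof (cases "b < c")
    case True
    show ?thesis
    proof (cases "a < d")
      case True
      then show ?thesis using wlog assms \<open>distinct _\<close> \<open>b < c\<close> by simp
    next
      case False
      have "(generic_skew d b * generic_skew c a + generic_skew d c * generic_skew b a
          :: 'k skew_poly) \<in> W_ideal n"
        using assms \<open>distinct _\<close> \<open>b < c\<close> False by (intro wlog) auto
      then show ?thesis
        by (simp add: generic_skew_swap[of d b] generic_skew_swap[of c a]
            generic_skew_swap[of d c] generic_skew_swap[of b a] algebra_simps)
    qed
  next
    case False
    show ?thesis
    proof (cases "a < d")
      case True
      have "(generic_skew a c * generic_skew b d + generic_skew a b * generic_skew c d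
          :: 'k skew_poly) \<in> W_ideal n"
        using assms \<open>distinct _\<close> \<open>\<not> b < c\<close> True by (intro wlog) auto
      then show ?thesis by (simp add: algebra_simps)
    next
      case False
      have "(generic_skew d c * generic_skew b a + generic_skew d b * generic_skew c a
          :: 'k skew_poly) \<in> W_ideal n"
        using assms \<open>distinct _\<close> \<open>\<not> b < c\<close> False by (intro wlog) auto
      then show ?thesis
        by (simp add: generic_skew_swap[of d b] generic_skew_swap[of c a]
            generic_skew_swap[of d c] generic_skew_swap[of b a] algebra_simps)
    qed
  qed
qed

text \<open>The counterpart of the wedge product of the listed letters. A flat list, rather than a
  list of pairs, lets a swap straddle the boundary between two factors. A last unpaired letter is
  dropped, so the relations below are stated for words of even length.\<close>

fun skew_word :: "nat list \<Rightarrow> 'k::field skew_poly" where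
  "skew_word (a # b # xs) = generic_skew a b * skew_word xs"
| "skew_word _ = 1"

lemma skew_word_append:
  "even (length xs) \<Longrightarrow> skew_word (xs @ ys) = skew_word xs * skew_word ys"
  by (induction xs rule: skew_word.induct) (auto simp: mult.assoc)

lemma skew_word_skew_polys: "set xs \<subseteq> {1..2 * n} \<Longrightarrow> skew_word xs \<in> skew_polys n"
  by (induction xs rule: skew_word.induct)
    (auto intro!: skew_polys_mult generic_skew_skew_polys)

text \<open>If \<open>a\<close> and \<open>b\<close> form a pair, skew symmetry makes the sum zero.
  Otherwise they are the middle letters of two neighbouring pairs \<open>p a\<close> and
  \<open>b q\<close>, and the exchange relation applies to these two factors.\<close>

lemma skew_word_swap:
  assumes "even (length (xs @ ys))" "set xs \<union> {a, b} \<union> set ys \<subseteq> {1..2 * n}"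
  shows "(skew_word (xs @ a # b # ys) + skew_word (xs @ b # a # ys) :: 'k::field skew_poly)
    \<in> W_ideal n"
proof (cases "even (length xs)")
  case True
  then show ?thesis
    by (simp add: skew_word_append generic_skew_swap[of b a])
next
  case False
  then obtain xs' p where xs: "xs = xs' @ [p]" "even (length xs')"
    by (cases xs rule: rev_cases) auto
  obtain q ys' where ys: "ys = q # ys'"
    using False assms(1) by (cases ys) auto
  have "skew_word (xs @ a # b # ys) + skew_word (xs @ b # a # ys)
    = skew_word xs' * skew_word ys'
      * (generic_skew p a * generic_skew b q + generic_skew p b * generic_skew a q :: 'k skew_poly)"
    using xs by (simp add: ys skew_word_append algebra_simps)
  also have "\<dots> \<in> W_ideal n"
    using assms(2) xs ys
    by (intro W_ideal_mult skew_polys_mult skew_word_skew_polys exchange_in_W_ideal) auto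
  finally show ?thesis .
qed

text \<open>Congruence modulo the ideal up to a global sign; it makes the sign of the sorting
  permutation irrelevant.\<close>

definition eq_upto_sign :: "nat \<Rightarrow> 'k::field skew_poly \<Rightarrow> 'k skew_poly \<Rightarrow> bool" where
  "eq_upto_sign n f g \<longleftrightarrow> f - g \<in> W_ideal n \<or> f + g \<in> W_ideal n"

lemma eq_upto_sign_refl [simp]: "eq_upto_sign n f f"
  by (simp add: eq_upto_sign_def)

lemma eq_upto_sign_trans [trans]:
  assumes "eq_upto_sign n f g" "eq_upto_sign n g h"
  shows "eq_upto_sign n f h"
proof -
  consider "f - g \<in> W_ideal n" "g - h \<in> W_ideal n" | "f - g \<in> W_ideal n" "g + h \<in> W_ideal n"
    | "f + g \<in> W_ideal n" "g - h \<in> W_ideal n" | "f + g \<in> W_ideal n" "g + h \<in> W_ideal n"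
    using assms by (auto simp: eq_upto_sign_def)
  then show ?thesis
    by cases (use W_ideal_add[of "f - g" n "g - h"] W_ideal_add[of "f - g" n "g + h"]
        W_ideal_diff[of "f + g" n "g - h"] W_ideal_diff[of "f + g" n "g + h"]
        in \<open>simp_all add: eq_upto_sign_def algebra_simps\<close>)
qed

text \<open>Each step of the insertion is one adjacent swap. The prefix \<open>xs\<close> may have
  either parity, so the letters that \<open>x\<close> has passed can be absorbed into it in the
  induction.\<close>

lemma skew_word_insort:
  assumes "odd (length (xs @ ys))" "insert x (set xs \<union> set ys) \<subseteq> {1..2 * n}"
  shows "eq_upto_sign n (skew_word (xs @ x # ys)) (skew_word (xs @ insort x ys) :: 'k::field skew_poly)"
  using assms
proof (induction ys arbitrary: xs)
  case (Cons y ys)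
  show ?case
  proof (cases "x \<le> y")
    case False
    have "eq_upto_sign n (skew_word (xs @ x # y # ys)) (skew_word (xs @ y # x # ys) :: 'k skew_poly)"
      unfolding eq_upto_sign_def
      by (rule disjI2, rule skew_word_swap) (use Cons.prems in auto)
    also have "eq_upto_sign n \<dots> (skew_word (xs @ y # insort x ys))"
      using Cons.IH[of "xs @ [y]"] Cons.prems by simp
    finally show ?thesis using False by simp
  qed simp
qed simp

lemma skew_word_sort:
  assumes "even (length (zs @ xs))" "set zs \<union> set xs \<subseteq> {1..2 * n}"
  shows "eq_upto_sign n (skew_word (zs @ xs)) (skew_word (zs @ sort xs) :: 'k::field skew_poly)"
  using assms
proof (induction xs arbitrary: zs)
  case (Cons x xs)
  have "eq_upto_sign n (skew_word (zs @ x # xs)) (skew_word (zs @ x # sort xs) :: 'k skew_poly)"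
    using Cons.IH[of "zs @ [x]"] Cons.prems by simp
  also have "eq_upto_sign n \<dots> (skew_word (zs @ insort x (sort xs)))"
    using Cons.prems by (intro skew_word_insort) auto
  finally show ?case by simp
qed simp

lemma sorted_not_distinct_adjacent:
  assumes "sorted xs" "\<not> distinct xs"
  obtains us a vs where "xs = us @ a # a # vs"
proof -
  have "\<exists>us a vs. xs = us @ a # a # vs" using assms
  proof (induction xs)
    case (Cons x xs)
    show ?case
    proof (cases "distinct xs")
      case True
      with Cons.prems have "x \<in> set xs" by simp
      with Cons.prems obtain ys where "xs = x # ys"
        by (cases xs) (auto intro: antisym)
      then show ?thesis by blast
    next
      case False
      with Cons obtain us a vs where "xs = us @ a # a # vs" by auto
      then have "x # xs = (x # us) @ a # a # vs" by simp
      then show ?thesis by blast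
    qed
  qed simp
  then show ?thesis using that by blast
qed

text \<open>Sorting makes two equal letters adjacent. Either they form a pair, and the factor is
  zero, or they belong to neighbouring pairs \<open>p a\<close> and \<open>a q\<close>, whose
  product lies in the ideal.\<close>

lemma skew_word_not_distinct:
  assumes "even (length xs)" "set xs \<subseteq> {1..2 * n}" "\<not> distinct xs"
  shows "(skew_word xs :: 'k::field skew_poly) \<in> W_ideal n"
proof -
  obtain us a vs where dec: "sort xs = us @ a # a # vs"
    using sorted_not_distinct_adjacent[of "sort xs"] assms(3) by auto
  have rng: "set us \<union> {a} \<union> set vs \<subseteq> {1..2 * n}"
    using assms(2) arg_cong[OF dec, of set] by auto
  have ev: "even (length us + length vs)"
    using assms(1) arg_cong[OF dec, of length] by simp
  have "(skew_word (sort xs) :: 'k skew_poly) \<in> W_ideal n"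
  proof (cases "even (length us)")
    case True
    then show ?thesis by (simp add: dec skew_word_append)
  next
    case False
    then obtain us' p where us: "us = us' @ [p]" "even (length us')"
      by (cases us rule: rev_cases) auto
    obtain q vs' where vs: "vs = q # vs'"
      using False ev by (cases vs) auto
    have "skew_word (sort xs)
      = skew_word us' * skew_word vs' * (generic_skew p a * generic_skew a q :: 'k skew_poly)"
      using us by (simp add: dec vs skew_word_append algebra_simps)
    also have "\<dots> \<in> W_ideal n"
      using rng us vs
      by (intro W_ideal_mult skew_polys_mult skew_word_skew_polys prod_not_distinct_in_W_ideal) auto
    finally show ?thesis .
  qed
  moreover have "eq_upto_sign n (skew_word xs) (skew_word (sort xs) :: 'k skew_poly)"
    using skew_word_sort[of "[]" xs n] assms by simp
  ultimately show ?thesis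
    using W_ideal_add[of "skew_word xs - skew_word (sort xs)" n "skew_word (sort xs)"]
      W_ideal_diff[of "skew_word xs + skew_word (sort xs)" n "skew_word (sort xs)"]
    by (auto simp: eq_upto_sign_def)
qed

lemma single_skew_word:
  assumes "Poly_Mapping.keys m \<subseteq> skew_vars n"
  obtains xs where "even (length xs)" "set xs \<subseteq> {1..2 * n}"
    "Poly_Mapping.single m 1 = (skew_word xs :: 'k::field skew_poly)"
proof -
  have "\<exists>xs. even (length xs) \<and> set xs \<subseteq> {1..2 * n}
      \<and> Poly_Mapping.single m 1 = (skew_word xs :: 'k skew_poly)"
    using assms
  proof (induction "monom_degree m" arbitrary: m rule: less_induct)
    case less
    show ?case
    proof (cases "m = 0")
      case True
      then show ?thesis by (intro exI[of _ "[]"]) auto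
    next
      case False
      then obtain v where v: "v \<in> Poly_Mapping.keys m"
        using keys_eq_empty by blast
      define m' where "m' = m - Poly_Mapping.single v 1"
      have m: "m = Poly_Mapping.single v 1 + m'"
        using v by (intro poly_mapping_eqI)
          (auto simp: m'_def lookup_add lookup_minus lookup_single in_keys_iff when_def)
      have "monom_degree m' < monom_degree m"
        by (simp add: m monom_degree_add) (simp add: monom_degree_def)
      moreover have "Poly_Mapping.keys m' \<subseteq> Poly_Mapping.keys m"
        by (auto simp: m'_def lookup_minus in_keys_iff)
      ultimately obtain xs where xs: "even (length xs)" "set xs \<subseteq> {1..2 * n}"
        "Poly_Mapping.single m' 1 = (skew_word xs :: 'k skew_poly)"
        using less by blast
      obtain i j where "v = (i, j)" "i < j" "1 \<le> i" "j \<le> 2 * n"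
        using v less.prems by (auto simp: skew_vars_def)
      then have "Poly_Mapping.single m 1 = (skew_word (i # j # xs) :: 'k skew_poly)"
        "set (i # j # xs) \<subseteq> {1..2 * n}"
        using xs by (auto simp: m generic_skew_def var_def mult_single simp flip: xs(3))
      then show ?thesis using xs(1) by (intro exI[of _ "i # j # xs"]) simp
    qed
  qed
  then show ?thesis using that by blast
qed

section \<open>Normal forms indexed by even sets\<close>

definition even_subsets :: "nat \<Rightarrow> nat set set" where
  "even_subsets n = {T. T \<subseteq> {1..2 * n} \<and> even (card T)}"

lemma finite_even_subsets [simp]: "finite (even_subsets n)"
  by (rule finite_subset[of _ "Pow {1..2 * n}"]) (auto simp: even_subsets_def)

definition normal_sum :: "nat \<Rightarrow> (nat set \<Rightarrow> 'k) \<Rightarrow> 'k::field skew_poly" where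
  "normal_sum n c = (\<Sum>T \<in> even_subsets n. scale (c T) (skew_word (sorted_list_of_set T)))"

lemma normal_sum_add: "normal_sum n (\<lambda>T. c T + d T) = normal_sum n c + normal_sum n d"
  by (simp add: normal_sum_def skew.scale_left_distrib sum.distrib)

lemma normal_sum_scale: "normal_sum n (\<lambda>T. a * c T) = scale a (normal_sum n c)"
  by (simp add: normal_sum_def skew.scale_sum_right)

lemma normal_sum_single:
  assumes "T \<in> even_subsets n"
  shows "normal_sum n (\<lambda>S. if S = T then a else 0) = scale a (skew_word (sorted_list_of_set T))"
proof -
  have "normal_sum n (\<lambda>S. if S = T then a else 0)
    = (\<Sum>S\<in>even_subsets n. if S = T then scale a (skew_word (sorted_list_of_set T)) else 0)"
    unfolding normal_sum_def by (intro sum.cong) auto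
  then show ?thesis using assms by simp
qed

lemma single_normal_sum:
  assumes "Poly_Mapping.keys m \<subseteq> skew_vars n"
  shows "\<exists>c. Poly_Mapping.single m 1 - normal_sum n c \<in> (W_ideal n :: 'k::field skew_poly set)"
proof -
  obtain xs where xs: "even (length xs)" "set xs \<subseteq> {1..2 * n}"
    "Poly_Mapping.single m 1 = (skew_word xs :: 'k skew_poly)"
    using single_skew_word[OF assms] by blast
  show ?thesis
  proof (cases "distinct xs")
    case False
    have "normal_sum n (\<lambda>_. 0) = (0 :: 'k skew_poly)" by (simp add: normal_sum_def)
    then show ?thesis
      using skew_word_not_distinct[OF xs(1,2) False] xs(3) by (metis diff_zero)
  next
    case True
    have "sort xs = sorted_list_of_set (set xs)"
      using True by (simp add: sorted_list_of_set_sort_remdups distinct_remdups_id)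
    then have "eq_upto_sign n (skew_word xs) (skew_word (sorted_list_of_set (set xs)) :: 'k skew_poly)"
      using skew_word_sort[of "[]" xs n] xs by simp
    moreover have T: "set xs \<in> even_subsets n"
      using True xs by (simp add: even_subsets_def distinct_card)
    ultimately consider
        "skew_word xs - scale 1 (skew_word (sorted_list_of_set (set xs)) :: 'k skew_poly) \<in> W_ideal n"
      | "skew_word xs - scale (-1) (skew_word (sorted_list_of_set (set xs)) :: 'k skew_poly) \<in> W_ideal n"
      by (auto simp: eq_upto_sign_def)
    then show ?thesis
      by cases (metis xs(3) normal_sum_single[OF T])+
  qed
qed

lemma skew_poly_normal_sum:
  assumes "f \<in> skew_polys n"
  obtains c where "f - normal_sum n c \<in> (W_ideal n :: 'k::field skew_poly set)"
proof -
  have *: "\<exists>c. (\<Sum>m\<in>M. scale (a m) (Poly_Mapping.single m 1)) - normal_sum n c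
      \<in> (W_ideal n :: 'k skew_poly set)"
    if "finite M" "\<forall>m\<in>M. Poly_Mapping.keys m \<subseteq> skew_vars n" for M and a :: "_ \<Rightarrow> 'k"
    using that
  proof (induction M)
    case empty
    show ?case by (intro exI[of _ "\<lambda>_. 0"]) (simp add: normal_sum_def)
  next
    case (insert m M)
    obtain c d where
      c: "(\<Sum>m\<in>M. scale (a m) (Poly_Mapping.single m 1)) - normal_sum n c \<in> (W_ideal n :: 'k skew_poly set)"
      and d: "Poly_Mapping.single m 1 - normal_sum n d \<in> (W_ideal n :: 'k skew_poly set)"
      using insert single_normal_sum[of m n] by blast
    show ?case
      using W_ideal_add[OF c W_ideal_scale[OF d, of "a m"]] insert.hyps
      by (intro exI[of _ "\<lambda>T. c T + a m * d T"])
        (simp add: normal_sum_add normal_sum_scale skew.scale_right_diff_distrib algebra_simps)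
  qed
  have "f = (\<Sum>m\<in>Poly_Mapping.keys f. scale (Poly_Mapping.lookup f m) (Poly_Mapping.single m 1))"
    by (intro poly_mapping_eqI)
      (auto simp: scale_def mult_single lookup_sum lookup_single when_def in_keys_iff)
  then show ?thesis
    using *[of "Poly_Mapping.keys f" "Poly_Mapping.lookup f"] assms that
    by (auto simp: skew_polys_def)
qed

section \<open>Contraction in coordinates\<close>

text \<open>The coefficient of the monomial \<open>b\<close> in the contraction of \<open>F\<close>
  by \<open>f\<close>; for \<open>b = 0\<close> it is the usual apolarity pairing. Annihilation
  becomes a family of scalar equations that are linear in \<open>f\<close>.\<close>

definition pairing :: "skew_monom \<Rightarrow> 'k::field skew_poly \<Rightarrow> 'k skew_poly \<Rightarrow> 'k" where
  "pairing b F f =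
    (\<Sum>a\<in>Poly_Mapping.keys f. Poly_Mapping.lookup f a * Poly_Mapping.lookup F (a + b))"

lemma lookup_scale: "Poly_Mapping.lookup (scale c f) m = c * Poly_Mapping.lookup f m"
  unfolding scale_def mult_map_scale_conv_mult[symmetric]
  by (simp add: Poly_Mapping.map.rep_eq when_def)

text \<open>A monomial \<open>a\<close> of \<open>f\<close> can produce \<open>b\<close> only from
  the single monomial \<open>a + b\<close> of \<open>F\<close>.\<close>

lemma lookup_contract: "Poly_Mapping.lookup (contract f F) b = pairing b F f"
proof -
  have *: "(\<Sum>b'\<in>Poly_Mapping.keys F. Poly_Mapping.lookup (scale (Poly_Mapping.lookup f a
      * Poly_Mapping.lookup F b') (contract_monom a b')) b)
    = Poly_Mapping.lookup f a * Poly_Mapping.lookup F (a + b)" for a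
  proof -
    have "Poly_Mapping.lookup (contract_monom a b' :: 'a skew_poly) b = (1 when b' = a + b)" for b'
    proof (cases "\<forall>v. Poly_Mapping.lookup a v \<le> Poly_Mapping.lookup b' v")
      case True
      then have "b' - a = b \<longleftrightarrow> b' = a + b"
        by (fastforce simp: poly_mapping_eq_iff fun_eq_iff lookup_minus lookup_add)
      then show ?thesis using True
        by (simp add: contract_monom_def lookup_single)
    next
      case False
      then have "b' \<noteq> a + b" by (auto simp: lookup_add)
      then show ?thesis using False by (auto simp: contract_monom_def)
    qed
    then show ?thesis
      by (simp add: lookup_scale when_def in_keys_iff if_distrib[of "(*) _"] cong: if_cong)
  qed
  show ?thesis
    by (simp add: contract_def pairing_def lookup_sum *)
qed

lemma pairing_zero [simp]: "pairing b F 0 = 0"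
  by (simp add: pairing_def)

lemma pairing_add: "pairing b F (f + g) = pairing b F f + pairing b F g"
  unfolding pairing_def by (rule setsum_keys_plus_distrib) (simp_all add: distrib_right)

lemma pairing_uminus: "pairing b F (- f) = - pairing b F f"
  by (rule minus_unique[symmetric]) (simp flip: pairing_add)

lemma pairing_diff: "pairing b F (f - g) = pairing b F f - pairing b F g"
  using pairing_add[of b F f "- g"] by (simp add: pairing_uminus)

lemma pairing_sum: "pairing b F (\<Sum>i\<in>A. f i) = (\<Sum>i\<in>A. pairing b F (f i))"
  by (induction A rule: infinite_finite_induct) (simp_all add: pairing_add)

lemma pairing_single:
  "pairing b F (Poly_Mapping.single a c) = c * Poly_Mapping.lookup F (a + b)"
  by (cases "c = 0") (simp_all add: pairing_def)

lemma poly_mapping_sum_single: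
  "(\<Sum>m\<in>Poly_Mapping.keys f. Poly_Mapping.single m (Poly_Mapping.lookup f m)) = f"
  by (intro poly_mapping_eqI) (auto simp: lookup_sum lookup_single when_def in_keys_iff)

text \<open>The module law of contraction in coordinates: a monomial factor becomes a shift of the
  tested monomial. It makes the annihilator an ideal and later trades a tested monomial for a
  factor.\<close>

lemma pairing_single_mult:
  "pairing b F (Poly_Mapping.single a c * g) = c * pairing (a + b) F g"
proof -
  have "Poly_Mapping.single a c * g
    = (\<Sum>m\<in>Poly_Mapping.keys g. Poly_Mapping.single (a + m) (c * Poly_Mapping.lookup g m))"
    by (subst poly_mapping_sum_single[of g, symmetric]) (simp add: sum_distrib_left mult_single)
  then have "pairing b F (Poly_Mapping.single a c * g) = (\<Sum>m\<in>Poly_Mapping.keys g.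
      c * Poly_Mapping.lookup g m * Poly_Mapping.lookup F (a + m + b))"
    by (simp only: pairing_sum pairing_single)
  then show ?thesis
    by (simp add: pairing_def sum_distrib_left ac_simps)
qed

lemma pairing_mult:
  "pairing b F (f * g) = (\<Sum>a\<in>Poly_Mapping.keys f. Poly_Mapping.lookup f a * pairing (a + b) F g)"
proof -
  have "f * g = (\<Sum>a\<in>Poly_Mapping.keys f. Poly_Mapping.single a (Poly_Mapping.lookup f a) * g)"
    by (simp add: poly_mapping_sum_single flip: sum_distrib_right)
  then show ?thesis by (simp add: pairing_sum pairing_single_mult)
qed

lemma pairing_scale: "pairing b F (scale c f) = c * pairing b F f"
  by (cases "c = 0") (simp_all add: scale_def pairing_mult)

lemma Ann_iff: "f \<in> Ann n F \<longleftrightarrow> f \<in> skew_polys n \<and> (\<forall>b. pairing b F f = 0)"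
  by (auto simp: Ann_def poly_mapping_eq_iff fun_eq_iff simp flip: lookup_contract)

lemma ideal_Ann: "ideal (Ann n F) (skew_ring n :: 'k::field skew_poly ring)"
proof (rule idealI)
  interpret R: cring "skew_ring n :: 'k skew_poly ring" by (rule cring_skew_ring)
  show "ring (skew_ring n :: 'k skew_poly ring)" by (rule R.ring_axioms)
  have inv: "\<ominus>\<^bsub>skew_ring n\<^esub> f = - f" if "f \<in> skew_polys n" for f :: "'k skew_poly"
    using that skew_polys_uminus[OF that]
    by (intro R.minus_equality) (auto simp: skew_ring_def)
  show "subgroup (Ann n F) (add_monoid (skew_ring n))"
    using inv unfolding a_inv_def
    by (intro subgroup.intro)
      (auto simp: Ann_iff pairing_add pairing_uminus skew_polys_add skew_polys_uminus,
       auto simp: skew_ring_def Ann_iff pairing_add skew_polys_add)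
  fix f g :: "'k skew_poly" assume "f \<in> Ann n F" "g \<in> carrier (skew_ring n)"
  then show "g \<otimes>\<^bsub>skew_ring n\<^esub> f \<in> Ann n F"
    by (auto simp: Ann_iff pairing_mult skew_ring_def skew_polys_mult)
  then show "f \<otimes>\<^bsub>skew_ring n\<^esub> g \<in> Ann n F"
    by (simp add: skew_ring_def mult.commute)
qed

section \<open>Coefficients of the Pfaffian\<close>

text \<open>The degree of a monomial, read as a multigraph on the indices, at the vertex \<open>v\<close>.\<close>

definition vertex_degree :: "skew_monom \<Rightarrow> nat \<Rightarrow> nat" where
  "vertex_degree m v =
    (\<Sum>p\<in>Poly_Mapping.keys m. Poly_Mapping.lookup m p * of_bool (v \<in> {fst p, snd p}))"

lemma vertex_degree_zero [simp]: "vertex_degree 0 v = 0"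
  by (simp add: vertex_degree_def)

lemma vertex_degree_add: "vertex_degree (a + b) v = vertex_degree a v + vertex_degree b v"
  unfolding vertex_degree_def by (rule setsum_keys_plus_distrib) (simp_all add: distrib_right)

lemma vertex_degree_sum: "vertex_degree (\<Sum>i\<in>A. f i) v = (\<Sum>i\<in>A. vertex_degree (f i) v)"
  by (induction A rule: infinite_finite_induct) (simp_all add: vertex_degree_add)

text \<open>Sorting the endpoints selects the variable that occurs in the ring, so
  \<open>edge\<close> is symmetric and all orientation signs stay in the coefficients.\<close>

definition edge :: "nat \<Rightarrow> nat \<Rightarrow> skew_monom" where
  "edge a b = Poly_Mapping.single (min a b, max a b) 1"

lemma vertex_degree_edge [simp]: "vertex_degree (edge a b) v = of_bool (v \<in> {a, b})"
  by (cases "a \<le> b") (simp_all add: vertex_degree_def edge_def disj_commute)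

lemma generic_skew_edge:
  assumes "a \<noteq> b"
  obtains e :: "'k::field" where "e = 1 \<or> e = - 1" "generic_skew a b = Poly_Mapping.single (edge a b) e"
proof (cases "a < b")
  case True
  then show ?thesis
    by (intro that[of 1]) (simp_all add: generic_skew_def var_def edge_def min_def max_def)
next
  case False
  then show ?thesis using assms
    by (intro that[of "-1"])
      (auto simp: generic_skew_def var_def edge_def min_def max_def single_uminus)
qed

lemma prod_generic_skew:
  assumes "finite K" "\<And>k. k \<in> K \<Longrightarrow> f k \<noteq> g k"
  obtains e :: "'k::field" where "e = 1 \<or> e = - 1"
    "(\<Prod>k\<in>K. generic_skew (f k) (g k)) = Poly_Mapping.single (\<Sum>k\<in>K. edge (f k) (g k)) e"
proof -
  have "\<exists>e :: 'k. (e = 1 \<or> e = - 1) \<and>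
    (\<Prod>k\<in>K. generic_skew (f k) (g k)) = Poly_Mapping.single (\<Sum>k\<in>K. edge (f k) (g k)) e"
    using assms
  proof (induction K)
    case (insert k K)
    then obtain e :: 'k where e: "e = 1 \<or> e = - 1"
      "(\<Prod>k\<in>K. generic_skew (f k) (g k)) = Poly_Mapping.single (\<Sum>k\<in>K. edge (f k) (g k)) e"
      by blast
    obtain d :: 'k where d: "d = 1 \<or> d = - 1"
      "generic_skew (f k) (g k) = Poly_Mapping.single (edge (f k) (g k)) d"
      using generic_skew_edge[of "f k" "g k"] insert.prems by blast
    have "(\<Prod>k\<in>insert k K. generic_skew (f k) (g k))
      = Poly_Mapping.single (\<Sum>k\<in>insert k K. edge (f k) (g k)) (d * e)"
      using insert.hyps by (simp add: e(2) d(2) mult_single)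
    moreover have "d * e = 1 \<or> d * e = - 1"
      using e(1) d(1) by auto
    ultimately show ?case by blast
  qed auto
  then show ?thesis using that by blast
qed

lemma skew_word_distinct:
  assumes "even (length xs)" "distinct xs"
  obtains m and e :: "'k::field" where "e = 1 \<or> e = - 1" "skew_word xs = Poly_Mapping.single m e"
    "\<forall>v. vertex_degree m v = of_bool (v \<in> set xs)"
proof -
  have "\<exists>m. \<exists>e :: 'k. (e = 1 \<or> e = - 1) \<and> skew_word xs = Poly_Mapping.single m e
    \<and> (\<forall>v. vertex_degree m v = of_bool (v \<in> set xs))"
    using assms
  proof (induction xs rule: skew_word.induct)
    case (1 a b xs)
    then obtain m and e :: 'k where m: "e = 1 \<or> e = - 1" "skew_word xs = Poly_Mapping.single m e"
      "\<forall>v. vertex_degree m v = of_bool (v \<in> set xs)"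
      by auto
    obtain d :: 'k where d: "d = 1 \<or> d = - 1"
      "generic_skew a b = Poly_Mapping.single (edge a b) d"
      using generic_skew_edge[of a b] 1(3) by auto
    show ?case
      using m(1,3) d(1) 1(3)
      by (intro exI[of _ "edge a b + m"] exI[of _ "d * e"])
        (auto simp: m(2) d(2) mult_single vertex_degree_add)
  next
    case "2_1"
    show ?case by (intro exI[of _ 0] exI[of _ 1]) simp
  qed simp
  then show ?thesis using that by blast
qed

section \<open>Terms of the Pfaffian for all permutations\<close>

definition pfaffian_term :: "nat \<Rightarrow> (nat \<Rightarrow> nat) \<Rightarrow> 'k::field skew_poly" where
  "pfaffian_term n \<sigma> =
    of_int (sign \<sigma>) * (\<Prod>i = 1..n. generic_skew (\<sigma> (2 * i - 1)) (\<sigma> (2 * i)))"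

definition matching_monom :: "nat \<Rightarrow> (nat \<Rightarrow> nat) \<Rightarrow> skew_monom" where
  "matching_monom n \<sigma> = (\<Sum>i = 1..n. edge (\<sigma> (2 * i - 1)) (\<sigma> (2 * i)))"

lemma pair_positions_neq:
  fixes i n :: nat
  assumes "\<sigma> permutes {1..2 * n}" "i \<in> {1..n}"
  shows "\<sigma> (2 * i - 1) \<noteq> \<sigma> (2 * i)"
  using assms(2) by (auto dest!: injD[OF permutes_inj[OF assms(1)]])

lemma pfaffian_term_single:
  assumes "\<sigma> permutes {1..2 * n}"
  obtains e :: "'k::field" where "e = 1 \<or> e = - 1"
    "pfaffian_term n \<sigma> = Poly_Mapping.single (matching_monom n \<sigma>) e"
proof -
  obtain e :: 'k where e: "e = 1 \<or> e = - 1"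
    "(\<Prod>i = 1..n. generic_skew (\<sigma> (2 * i - 1)) (\<sigma> (2 * i)))
      = Poly_Mapping.single (matching_monom n \<sigma>) e"
    unfolding matching_monom_def
    using prod_generic_skew[of "{1..n}" "\<lambda>i. \<sigma> (2 * i - 1)" "\<lambda>i. \<sigma> (2 * i)", where 'k = 'k,
        OF finite_atLeastAtMost pair_positions_neq[OF assms]] by blast
  show ?thesis
  proof (rule that[of "of_int (sign \<sigma>) * e"])
    show "of_int (sign \<sigma>) * e = 1 \<or> of_int (sign \<sigma>) * e = - 1"
      using e(1) by (auto simp: sign_def)
    have "of_int (sign \<sigma>) = Poly_Mapping.single (0 :: skew_monom) (of_int (sign \<sigma>) :: 'k)"
      by (simp only: single_of_int)
    then show "pfaffian_term n \<sigma>
      = Poly_Mapping.single (matching_monom n \<sigma>) (of_int (sign \<sigma>) * e)"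
      by (simp only: pfaffian_term_def e(2) mult_single add_0)
  qed
qed

lemma vertex_degree_matching_monom:
  assumes "\<sigma> permutes {1..2 * n}" "v \<in> {1..2 * n}"
  shows "vertex_degree (matching_monom n \<sigma>) v = 1"
proof -
  obtain k where k: "k \<in> {1..2 * n}" "v = \<sigma> k"
    using permutes_image[OF assms(1)] assms(2) by blast
  \<comment> \<open>Position \<open>k\<close> belongs to pair number \<open>(k + 1) div 2\<close>
    and to no other.\<close>
  have "vertex_degree (matching_monom n \<sigma>) v = (\<Sum>i = 1..n. if i = (k + 1) div 2 then 1 else 0)"
    unfolding matching_monom_def vertex_degree_sum vertex_degree_edge
  proof (rule sum.cong)
    fix i assume "i \<in> {1..n}"
    then have "v \<in> {\<sigma> (2 * i - 1), \<sigma> (2 * i)} \<longleftrightarrow> i = (k + 1) div 2"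
      unfolding k insert_iff empty_iff inj_eq[OF permutes_inj[OF assms(1)]]
      by simp presburger
    then show "of_bool (v \<in> {\<sigma> (2 * i - 1), \<sigma> (2 * i)}) = (if i = (k + 1) div 2 then 1 else 0)"
      by simp
  qed simp
  then show ?thesis using k by auto
qed

text \<open>Two signs cancel: that of the transposition and that of the reversed entry.\<close>

lemma pfaffian_term_flip:
  assumes "\<sigma> permutes {1..2 * n}" "i \<in> {1..n}"
  shows "pfaffian_term n (\<sigma> \<circ> transpose (2 * i - 1) (2 * i)) = pfaffian_term n \<sigma>"
proof -
  let ?\<tau> = "\<sigma> \<circ> transpose (2 * i - 1) (2 * i)"
  have "sign ?\<tau> = - sign \<sigma>"
    using assms by (subst sign_compose)
      (auto simp: sign_swap_id permutation_swap_id intro: permutation_permutes[THEN iffD2])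
  moreover have "(\<Prod>k\<in>{1..n} - {i}. generic_skew (?\<tau> (2 * k - 1)) (?\<tau> (2 * k)))
    = (\<Prod>k\<in>{1..n} - {i}. generic_skew (\<sigma> (2 * k - 1)) (\<sigma> (2 * k)) :: 'a skew_poly)"
  proof (rule prod.cong)
    fix k assume "k \<in> {1..n} - {i}"
    then have "2 * k - 1 \<notin> {2 * i - 1, 2 * i}" "2 * k \<notin> {2 * i - 1, 2 * i}"
      by (auto; presburger)+
    then show "generic_skew (?\<tau> (2 * k - 1)) (?\<tau> (2 * k))
      = (generic_skew (\<sigma> (2 * k - 1)) (\<sigma> (2 * k)) :: 'a skew_poly)"
      by (simp add: transpose_def)
  qed simp
  ultimately show ?thesis
    using assms(2) unfolding pfaffian_term_def
    by (simp add: prod.remove[OF finite_atLeastAtMost assms(2)]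
        generic_skew_swap[of "\<sigma> (2 * i)"] del: One_nat_def)
qed

text \<open>The two transpositions have the same sign (both are trivial if \<open>i = j\<close>), so
  their composition is even, and the product is only reindexed along the transposition of
  \<open>i\<close> and \<open>j\<close>.\<close>

lemma pfaffian_term_swap_pairs:
  assumes "\<sigma> permutes {1..2 * n}" "i \<in> {1..n}" "j \<in> {1..n}"
  shows "pfaffian_term n (\<sigma> \<circ> (transpose (2 * i - 1) (2 * j - 1) \<circ> transpose (2 * i) (2 * j)))
    = pfaffian_term n \<sigma>"
proof -
  let ?\<tau> = "transpose (2 * i - 1) (2 * j - 1) \<circ> transpose (2 * i) (2 * j)"
  have sgn: "sign ?\<tau> = 1"
    using assms(2,3) by (subst sign_compose) (auto simp: sign_swap_id permutation_swap_id)
  have "sign (\<sigma> \<circ> ?\<tau>) = sign \<sigma> * sign ?\<tau>"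
    using assms(1) by (intro sign_compose permutation_compose permutation_swap_id)
      (auto simp: permutation_permutes)
  then have "sign (\<sigma> \<circ> ?\<tau>) = sign \<sigma>" by (simp only: sgn mult_1_right)
  moreover have "(\<Prod>k = 1..n. generic_skew ((\<sigma> \<circ> ?\<tau>) (2 * k - 1)) ((\<sigma> \<circ> ?\<tau>) (2 * k)))
    = (\<Prod>k = 1..n. generic_skew (\<sigma> (2 * k - 1)) (\<sigma> (2 * k)) :: 'a skew_poly)"
  proof -
    have "(\<Prod>k = 1..n. generic_skew (\<sigma> (2 * k - 1)) (\<sigma> (2 * k)) :: 'a skew_poly)
      = (\<Prod>k = 1..n. generic_skew (\<sigma> (2 * transpose i j k - 1)) (\<sigma> (2 * transpose i j k)))"
      using prod.permute[OF permutes_swap_id[OF assms(2,3)],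
          of "\<lambda>k. generic_skew (\<sigma> (2 * k - 1)) (\<sigma> (2 * k)) :: 'a skew_poly"]
      by (simp add: comp_def)
    also have "\<dots> = (\<Prod>k = 1..n. generic_skew ((\<sigma> \<circ> ?\<tau>) (2 * k - 1)) ((\<sigma> \<circ> ?\<tau>) (2 * k)))"
    proof (rule prod.cong)
      fix k assume k: "k \<in> {1..n}"
      have "?\<tau> (2 * k) = 2 * transpose i j k"
        using k assms(2,3) by (auto simp: transpose_def; presburger)
      moreover have "?\<tau> (2 * k - 1) = 2 * transpose i j k - 1"
        using k assms(2,3) by (auto simp: transpose_def; presburger)
      ultimately show "generic_skew (\<sigma> (2 * transpose i j k - 1)) (\<sigma> (2 * transpose i j k))
        = (generic_skew ((\<sigma> \<circ> ?\<tau>) (2 * k - 1)) ((\<sigma> \<circ> ?\<tau>) (2 * k)) :: 'a skew_poly)"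
        by (simp only: comp_apply)
    qed simp
    finally show ?thesis by simp
  qed
  ultimately show ?thesis unfolding pfaffian_term_def by simp
qed

text \<open>This is (p - q)(x - y) > 0, written without subtraction.\<close>

lemma rearrangement_nat:
  fixes p q x y :: nat
  assumes "q < p" "y < x"
  shows "p * y + q * x < p * x + q * y"
proof -
  obtain d e where "q + d = p" "0 < d" "y + e = x" "0 < e"
    using less_imp_add_positive[OF assms(1)] less_imp_add_positive[OF assms(2)] by blast
  then show ?thesis by (auto simp: algebra_simps)
qed

text \<open>
  Flipping a pair or interchanging two pairs does not change the term, and whenever the ordering
  conditions fail, one of these moves lowers the weight \<open>wt\<close>.
\<close>

lemma pfaffian_term_normal_form:
  assumes "\<sigma> permutes {1..2 * n}"
  obtains \<rho> where "\<rho> \<in> pfaffian_perms n"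
    "pfaffian_term n \<rho> = (pfaffian_term n \<sigma> :: 'k::field skew_poly)"
proof -
  \<comment> \<open>The factors \<open>n + 1 - i\<close> are positive, so a flip that lowers a first
    entry lowers the weight. They decrease strictly in \<open>i\<close>, so moving the smaller of
    two first entries to the earlier pair lowers it too. Second entries do not contribute.\<close>
  define wt where "wt \<rho> = (\<Sum>i = 1..n. (n + 1 - i) * \<rho> (2 * i - 1))" for \<rho> :: "nat \<Rightarrow> nat"
  let ?P = "\<lambda>\<rho>. \<rho> permutes {1..2 * n} \<and> pfaffian_term n \<rho> = (pfaffian_term n \<sigma> :: 'k skew_poly)"
  obtain \<rho> where \<rho>: "\<rho> permutes {1..2 * n}"
    "pfaffian_term n \<rho> = (pfaffian_term n \<sigma> :: 'k skew_poly)"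
    and min: "\<And>\<tau>. ?P \<tau> \<Longrightarrow> wt \<rho> \<le> wt \<tau>"
    using ex_has_least_nat[of ?P \<sigma> wt] assms by blast
  note inj = inj_eq[OF permutes_inj[OF \<rho>(1)]]
  have "\<rho> (2 * i - 1) < \<rho> (2 * i)" if i: "i \<in> {1..n}" for i
  proof (rule ccontr)
    assume "\<not> \<rho> (2 * i - 1) < \<rho> (2 * i)"
    then have lt: "\<rho> (2 * i) < \<rho> (2 * i - 1)"
      using pair_positions_neq[OF \<rho>(1) i] by simp
    let ?\<tau> = "\<rho> \<circ> transpose (2 * i - 1) (2 * i)"
    have "?\<tau> permutes {1..2 * n}"
      using i by (intro permutes_compose[OF permutes_swap_id \<rho>(1)]) auto
    then have "wt \<rho> \<le> wt ?\<tau>"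
      using min pfaffian_term_flip[OF \<rho>(1) i] \<rho>(2) by metis
    moreover have "(\<Sum>k\<in>{1..n} - {i}. (n + 1 - k) * ?\<tau> (2 * k - 1))
      = (\<Sum>k\<in>{1..n} - {i}. (n + 1 - k) * \<rho> (2 * k - 1))"
    proof (rule sum.cong)
      fix k assume "k \<in> {1..n} - {i}"
      then have "2 * k - 1 \<notin> {2 * i - 1, 2 * i}" by (auto; presburger)
      then show "(n + 1 - k) * ?\<tau> (2 * k - 1) = (n + 1 - k) * \<rho> (2 * k - 1)"
        by (simp add: transpose_def)
    qed simp
    ultimately have "(n + 1 - i) * \<rho> (2 * i - 1) \<le> (n + 1 - i) * \<rho> (2 * i)"
      using i unfolding wt_def by (simp add: sum.remove[OF finite_atLeastAtMost i] del: One_nat_def)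
    then show False using lt i by auto
  qed
  moreover have "\<rho> (2 * i - 1) < \<rho> (2 * j - 1)" if ij: "i \<in> {1..n}" "j \<in> {1..n}" "i < j" for i j
  proof (rule ccontr)
    assume "\<not> \<rho> (2 * i - 1) < \<rho> (2 * j - 1)"
    moreover have "\<rho> (2 * i - 1) \<noteq> \<rho> (2 * j - 1)"
      using ij by (auto simp: inj)
    ultimately have lt: "\<rho> (2 * j - 1) < \<rho> (2 * i - 1)" by simp
    have weights: "n + 1 - j < n + 1 - i"
      using ij by auto
    let ?\<tau> = "\<rho> \<circ> (transpose (2 * i - 1) (2 * j - 1) \<circ> transpose (2 * i) (2 * j))"
    have "?\<tau> permutes {1..2 * n}"
      using ij by (intro permutes_compose[OF _ \<rho>(1)] permutes_compose permutes_swap_id) auto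
    then have "wt \<rho> \<le> wt ?\<tau>"
      using min pfaffian_term_swap_pairs[OF \<rho>(1) ij(1,2)] \<rho>(2) by metis
    moreover have fin: "finite ({1..n} - {i})" and j: "j \<in> {1..n} - {i}"
      using ij by auto
    moreover have "(\<Sum>k\<in>{1..n} - {i} - {j}. (n + 1 - k) * ?\<tau> (2 * k - 1))
      = (\<Sum>k\<in>{1..n} - {i} - {j}. (n + 1 - k) * \<rho> (2 * k - 1))"
    proof (rule sum.cong)
      fix k assume "k \<in> {1..n} - {i} - {j}"
      then have "2 * k - 1 \<notin> {2 * i - 1, 2 * i, 2 * j - 1, 2 * j}" using ij by (auto; presburger)
      then show "(n + 1 - k) * ?\<tau> (2 * k - 1) = (n + 1 - k) * \<rho> (2 * k - 1)"
        by (simp add: transpose_def)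
    qed simp
    moreover have "?\<tau> (2 * i - 1) = \<rho> (2 * j - 1)" "?\<tau> (2 * j - 1) = \<rho> (2 * i - 1)"
      using ij by (auto simp: transpose_def; presburger)+
    ultimately have le: "(n + 1 - i) * \<rho> (2 * i - 1) + (n + 1 - j) * \<rho> (2 * j - 1)
        \<le> (n + 1 - i) * \<rho> (2 * j - 1) + (n + 1 - j) * \<rho> (2 * i - 1)"
      unfolding wt_def sum.remove[OF finite_atLeastAtMost ij(1)] sum.remove[OF fin j]
      by (simp del: comp_apply One_nat_def)
    from leD[OF le] rearrangement_nat[OF weights lt] show False by blast
  qed
  ultimately have "\<rho> \<in> pfaffian_perms n"
    using \<rho>(1) by (simp add: pfaffian_perms_def)
  then show ?thesis using that \<rho>(2) by blast
qed

text \<open>The monomial determines the set of pairs. The first entries are the increasing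
  enumeration of its first components, and each first entry determines its partner. Hence no two
  summands of the Pfaffian can merge or cancel.\<close>

lemma inj_on_matching_monom: "inj_on (matching_monom n) (pfaffian_perms n)"
proof (rule inj_onI)
  fix \<rho> \<rho>' assume P: "\<rho> \<in> pfaffian_perms n" "\<rho>' \<in> pfaffian_perms n"
    and eq: "matching_monom n \<rho> = matching_monom n \<rho>'"
  have keys: "Poly_Mapping.keys (matching_monom n \<sigma>) = (\<lambda>i. (\<sigma> (2 * i - 1), \<sigma> (2 * i))) ` {1..n}"
    if "\<sigma> \<in> pfaffian_perms n" for \<sigma>
  proof -
    have "matching_monom n \<sigma> = (\<Sum>i = 1..n. Poly_Mapping.single (\<sigma> (2 * i - 1), \<sigma> (2 * i)) 1)"
      unfolding matching_monom_def using that
      by (intro sum.cong) (auto simp: edge_def pfaffian_perms_def min_def max_def dest!: bspec)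
    then have "p \<in> Poly_Mapping.keys (matching_monom n \<sigma>)
        \<longleftrightarrow> (\<exists>i\<in>{1..n}. (\<sigma> (2 * i - 1), \<sigma> (2 * i)) = p)" for p
      by (simp add: in_keys_iff lookup_sum lookup_single when_def)
    then show ?thesis by fastforce
  qed
  have pairs: "(\<lambda>i. (\<rho> (2 * i - 1), \<rho> (2 * i))) ` {1..n} = (\<lambda>i. (\<rho>' (2 * i - 1), \<rho>' (2 * i))) ` {1..n}"
    using keys[OF P(1)] keys[OF P(2)] eq by simp
  have sorted: "sorted_wrt (<) (map (\<lambda>i. \<sigma> (2 * i - 1)) [1..<n + 1])" if "\<sigma> \<in> pfaffian_perms n" for \<sigma>
    unfolding sorted_wrt_map
    by (rule sorted_wrt_mono_rel[OF _ sorted_wrt_upt]) (use that in \<open>auto simp: pfaffian_perms_def\<close>)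
  have "fst ` (\<lambda>i. (\<rho> (2 * i - 1), \<rho> (2 * i))) ` {1..n} = fst ` (\<lambda>i. (\<rho>' (2 * i - 1), \<rho>' (2 * i))) ` {1..n}"
    using pairs by simp
  then have "(\<lambda>i. \<rho> (2 * i - 1)) ` {1..n} = (\<lambda>i. \<rho>' (2 * i - 1)) ` {1..n}"
    by (simp add: image_image)
  then have "map (\<lambda>i. \<rho> (2 * i - 1)) [1..<n + 1] = map (\<lambda>i. \<rho>' (2 * i - 1)) [1..<n + 1]"
    by (intro strict_sorted_equal sorted P)
      (simp only: set_map set_upt Suc_eq_plus1[symmetric] atLeastLessThanSuc_atLeastAtMost)
  then have odd: "\<rho> (2 * i - 1) = \<rho>' (2 * i - 1)" if "i \<in> {1..n}" for i
    using that unfolding map_eq_conv set_upt by simp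
  have perm: "\<rho> permutes {1..2 * n}" "\<rho>' permutes {1..2 * n}"
    using P by (auto simp: pfaffian_perms_def)
  have even: "\<rho> (2 * i) = \<rho>' (2 * i)" if i: "i \<in> {1..n}" for i
  proof -
    have "(\<rho> (2 * i - 1), \<rho> (2 * i)) \<in> (\<lambda>i. (\<rho>' (2 * i - 1), \<rho>' (2 * i))) ` {1..n}"
      using i pairs by blast
    then obtain j where j: "j \<in> {1..n}" "\<rho> (2 * i - 1) = \<rho>' (2 * j - 1)" "\<rho> (2 * i) = \<rho>' (2 * j)"
      by auto
    then have "2 * i - 1 = 2 * j - 1"
      using odd[OF i] inj_eq[OF permutes_inj[OF perm(2)]] by metis
    then have "i = j" using i j(1) by auto
    then show ?thesis using j(3) by simp
  qed
  show "\<rho> = \<rho>'"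
  proof
    fix k
    consider "k \<notin> {1..2 * n}" | i where "i \<in> {1..n}" "k = 2 * i" | i where "i \<in> {1..n}" "k = 2 * i - 1"
    proof (cases "k \<in> {1..2 * n}")
      case True
      show ?thesis
      proof (cases "even k")
        case True
        then show ?thesis using \<open>k \<in> _\<close> that(2)[of "k div 2"] by auto
      next
        case False
        then show ?thesis using \<open>k \<in> _\<close> that(3)[of "(k + 1) div 2"] by (auto elim!: oddE)
      qed
    qed (use that in blast)
    then show "\<rho> k = \<rho>' k"
      by cases (use odd even permutes_not_in[OF perm(1)] permutes_not_in[OF perm(2)] in auto)
  qed
qed

lemma single_eq_singleD:
  assumes "Poly_Mapping.single m c = Poly_Mapping.single m' c'" "c \<noteq> 0"
  shows "m = m'" "c = c'"
proof -
  have "Poly_Mapping.lookup (Poly_Mapping.single m' c') m = c"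
    using assms(1) by (metis lookup_single_eq)
  then show "m = m'" "c = c'"
    using assms(2) by (auto simp: lookup_single when_def split: if_splits)
qed

abbreviation (input) generic_pfaffian :: "nat \<Rightarrow> 'k::field skew_poly" where
  "generic_pfaffian n \<equiv> pfaffian n generic_skew"

lemma generic_pfaffian_sum: "generic_pfaffian n = (\<Sum>\<rho>\<in>pfaffian_perms n. pfaffian_term n \<rho>)"
  by (simp add: pfaffian_def pfaffian_term_def)

text \<open>Normalising \<sigma> keeps its term, and by injectivity no other normalised summand
  contributes to this monomial.\<close>

lemma lookup_generic_pfaffian:
  assumes "\<sigma> permutes {1..2 * n}" "pfaffian_term n \<sigma> = Poly_Mapping.single m c" "c \<noteq> 0"
  shows "Poly_Mapping.lookup (generic_pfaffian n) m = (c :: 'k::field)"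
proof -
  obtain \<rho> where \<rho>: "\<rho> \<in> pfaffian_perms n" "pfaffian_term n \<rho> = Poly_Mapping.single m c"
    using pfaffian_term_normal_form[OF assms(1)] assms(2) by metis
  have mono: "\<exists>e :: 'k. pfaffian_term n \<tau> = Poly_Mapping.single (matching_monom n \<tau>) e"
    if "\<tau> \<in> pfaffian_perms n" for \<tau>
  proof -
    have "\<tau> permutes {1..2 * n}" using that by (simp add: pfaffian_perms_def)
    from pfaffian_term_single[OF this, where 'k = 'k] show ?thesis by metis
  qed
  have m: "m = matching_monom n \<rho>"
    using mono[OF \<rho>(1)] single_eq_singleD(1) \<rho>(2) assms(3) by metis
  have "Poly_Mapping.lookup (pfaffian_term n \<tau>) m = (if \<tau> = \<rho> then c else 0)"
    if \<tau>: "\<tau> \<in> pfaffian_perms n" for \<tau>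
  proof (cases "\<tau> = \<rho>")
    case False
    then have "matching_monom n \<tau> \<noteq> m"
      using inj_on_matching_monom \<rho>(1) \<tau> m by (auto dest: inj_onD)
    then show ?thesis using mono[OF \<tau>] False by (auto simp: lookup_single)
  qed (simp add: \<rho>(2))
  moreover have "finite (pfaffian_perms n)"
    by (rule finite_subset[OF _ finite_permutations[of "{1..2 * n}"]]) (auto simp: pfaffian_perms_def)
  ultimately show ?thesis
    using \<rho>(1) by (simp add: generic_pfaffian_sum lookup_sum)
qed

lemma lookup_generic_pfaffian_nonzero:
  assumes "Poly_Mapping.lookup (generic_pfaffian n :: 'k::field skew_poly) m \<noteq> 0"
  obtains \<rho> where "\<rho> permutes {1..2 * n}" "matching_monom n \<rho> = m"
proof -
  obtain \<rho> where \<rho>: "\<rho> \<in> pfaffian_perms n"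
    "Poly_Mapping.lookup (pfaffian_term n \<rho> :: 'k skew_poly) m \<noteq> 0"
    using assms sum.not_neutral_contains_not_neutral
    unfolding generic_pfaffian_sum lookup_sum by metis
  then have perm: "\<rho> permutes {1..2 * n}" by (simp add: pfaffian_perms_def)
  obtain e :: 'k where "pfaffian_term n \<rho> = Poly_Mapping.single (matching_monom n \<rho>) e"
    using pfaffian_term_single[OF perm] by blast
  then show ?thesis using \<rho>(2) perm that
    by (auto simp: lookup_single when_def split: if_splits)
qed

section \<open>Pairing the Pfaffian with products of two entries\<close>

lemma vertex_degree_generic_pfaffian:
  assumes "Poly_Mapping.lookup (generic_pfaffian n) m \<noteq> 0" "v \<in> {1..2 * n}"
  shows "vertex_degree m v = 1"
  using lookup_generic_pfaffian_nonzero[OF assms(1)] vertex_degree_matching_monom[OF _ assms(2)]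
  by metis

text \<open>A letter shared by the two factors has degree at least two in every monomial that is
  tested, whereas it has degree one in the monomials of the Pfaffian.\<close>

lemma pairing_not_distinct:
  assumes "{a, b, c, d} \<subseteq> {1..2 * n}" "\<not> distinct [a, b, c, d]"
  shows "pairing m (generic_pfaffian n) (generic_skew a b * generic_skew c d) = (0 :: 'k::field)"
proof (cases "a = b \<or> c = d")
  case False
  obtain e where e: "generic_skew a b = Poly_Mapping.single (edge a b) (e :: 'k)"
    using generic_skew_edge[of a b, where 'k = 'k] False by blast
  obtain e' where e': "generic_skew c d = Poly_Mapping.single (edge c d) (e' :: 'k)"
    using generic_skew_edge[of c d, where 'k = 'k] False by blast
  obtain v where v: "v \<in> {a, b}" "v \<in> {c, d}"
    using assms(2) False by auto
  then have "vertex_degree (edge a b + edge c d + m) v \<noteq> 1"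
    by (simp add: vertex_degree_add)
  moreover have "v \<in> {1..2 * n}" using v assms(1) by blast
  ultimately have "Poly_Mapping.lookup (generic_pfaffian n :: 'k skew_poly) (edge a b + edge c d + m) = 0"
    using vertex_degree_generic_pfaffian by blast
  then show ?thesis by (simp add: e e' mult_single pairing_single)
qed auto

lemma permutation_orient_pair:
  assumes "\<sigma> permutes {1..2 * n}" "i \<in> {1..n}" "edge (\<sigma> (2 * i - 1)) (\<sigma> (2 * i)) = edge a b"
  obtains \<tau> where "\<tau> permutes {1..2 * n}"
    "pfaffian_term n \<tau> = (pfaffian_term n \<sigma> :: 'k::field skew_poly)"
    "\<tau> (2 * i - 1) = a" "\<tau> (2 * i) = b" "\<And>k. k \<notin> {2 * i - 1, 2 * i} \<Longrightarrow> \<tau> k = \<sigma> k"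
proof -
  have "(min (\<sigma> (2 * i - 1)) (\<sigma> (2 * i)), max (\<sigma> (2 * i - 1)) (\<sigma> (2 * i))) = (min a b, max a b)"
    by (rule single_eq_singleD(1)[OF assms(3)[unfolded edge_def]]) simp
  then consider "\<sigma> (2 * i - 1) = a" "\<sigma> (2 * i) = b" | "\<sigma> (2 * i - 1) = b" "\<sigma> (2 * i) = a"
    by (auto simp: min_def max_def split: if_splits)
  then show ?thesis
  proof cases
    case 1
    then show ?thesis using that[of \<sigma>] assms(1) by blast
  next
    case 2
    have "\<sigma> \<circ> transpose (2 * i - 1) (2 * i) permutes {1..2 * n}"
      using assms(2) by (intro permutes_compose[OF permutes_swap_id assms(1)]) auto
    then show ?thesis
      using 2 pfaffian_term_flip[OF assms(1,2)]
      by (intro that[of "\<sigma> \<circ> transpose (2 * i - 1) (2 * i)"]) (simp_all add: transpose_def)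
  qed
qed

text \<open>Supplies a representative of the matching in which both prescribed edges occur as pairs
  with prescribed orientation, ready for a transposition of letters. Flipping pairs suffices, since
  flips keep the term.\<close>

lemma pfaffian_matching_permutation:
  assumes "Poly_Mapping.lookup (generic_pfaffian n :: 'k::field skew_poly) (edge a b + edge c d + m) \<noteq> 0"
    and "distinct [a, b, c, d]"
  obtains \<sigma> i j where "\<sigma> permutes {1..2 * n}" "i \<in> {1..n}" "j \<in> {1..n}" "i \<noteq> j"
    "\<sigma> (2 * i - 1) = a" "\<sigma> (2 * i) = b" "\<sigma> (2 * j - 1) = c" "\<sigma> (2 * j) = d"
    "pfaffian_term n \<sigma> = Poly_Mapping.single (edge a b + edge c d + m)
      (Poly_Mapping.lookup (generic_pfaffian n :: 'k skew_poly) (edge a b + edge c d + m))"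
proof -
  obtain \<rho> where \<rho>: "\<rho> permutes {1..2 * n}" "matching_monom n \<rho> = edge a b + edge c d + m"
    using lookup_generic_pfaffian_nonzero[OF assms(1)] by blast
  have pf_term: "pfaffian_term n \<rho> = Poly_Mapping.single (edge a b + edge c d + m)
      (Poly_Mapping.lookup (generic_pfaffian n :: 'k skew_poly) (edge a b + edge c d + m))"
  proof -
    obtain e :: 'k where e: "e = 1 \<or> e = - 1"
      "pfaffian_term n \<rho> = Poly_Mapping.single (edge a b + edge c d + m) e"
      using pfaffian_term_single[OF \<rho>(1), where 'k = 'k] \<rho>(2) by metis
    then have "Poly_Mapping.lookup (generic_pfaffian n) (edge a b + edge c d + m) = e"
      using lookup_generic_pfaffian[OF \<rho>(1) e(2)] by fastforce
    then show ?thesis using e(2) by simp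
  qed
  have position: "\<exists>i\<in>{1..n}. edge (\<rho> (2 * i - 1)) (\<rho> (2 * i)) = edge x y"
    if "matching_monom n \<rho> = edge x y + r" for x y r
  proof -
    have "(min x y, max x y) \<in> Poly_Mapping.keys (matching_monom n \<rho>)"
      by (simp add: that in_keys_iff lookup_add edge_def)
    then obtain i where "i \<in> {1..n}"
      "(min x y, max x y) \<in> Poly_Mapping.keys (edge (\<rho> (2 * i - 1)) (\<rho> (2 * i)))"
      using subsetD[OF keys_sum] unfolding matching_monom_def by fast
    then show ?thesis by (intro bexI[of _ i]) (auto simp: edge_def)
  qed
  obtain i where i: "i \<in> {1..n}" "edge (\<rho> (2 * i - 1)) (\<rho> (2 * i)) = edge a b"
    using position[of a b "edge c d + m"] \<rho>(2) by (auto simp: ac_simps)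
  obtain j where j: "j \<in> {1..n}" "edge (\<rho> (2 * j - 1)) (\<rho> (2 * j)) = edge c d"
    using position[of c d "edge a b + m"] \<rho>(2) by (auto simp: ac_simps)
  \<comment> \<open>The letter \<open>a\<close> distinguishes the two edges, so they occupy
    different pairs.\<close>
  have "vertex_degree (edge a b) a \<noteq> vertex_degree (edge c d) a"
    using assms(2) by simp
  then have "edge a b \<noteq> edge c d" by metis
  then have "i \<noteq> j" using i(2) j(2) by metis
  obtain \<tau> where \<tau>: "\<tau> permutes {1..2 * n}"
    "pfaffian_term n \<tau> = (pfaffian_term n \<rho> :: 'k skew_poly)"
    "\<tau> (2 * i - 1) = a" "\<tau> (2 * i) = b" "\<And>k. k \<notin> {2 * i - 1, 2 * i} \<Longrightarrow> \<tau> k = \<rho> k"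
    using permutation_orient_pair[OF \<rho>(1) i] by metis
  have ij: "{2 * i - 1, 2 * i} \<inter> {2 * j - 1, 2 * j} = {}"
    using i(1) j(1) \<open>i \<noteq> j\<close> by (auto; presburger)
  then have "edge (\<tau> (2 * j - 1)) (\<tau> (2 * j)) = edge c d"
    using j(2) \<tau>(5) by auto
  then obtain \<sigma> where \<sigma>: "\<sigma> permutes {1..2 * n}"
    "pfaffian_term n \<sigma> = (pfaffian_term n \<tau> :: 'k skew_poly)"
    "\<sigma> (2 * j - 1) = c" "\<sigma> (2 * j) = d" "\<And>k. k \<notin> {2 * j - 1, 2 * j} \<Longrightarrow> \<sigma> k = \<tau> k"
    using permutation_orient_pair[OF \<tau>(1) j(1)] by metis
  show ?thesis
  proof (rule that[OF \<sigma>(1) i(1) j(1) \<open>i \<noteq> j\<close> _ _ \<sigma>(3,4)])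
    show "\<sigma> (2 * i - 1) = a" "\<sigma> (2 * i) = b"
      using ij \<sigma>(5) \<tau>(3,4) by auto
  qed (simp add: \<sigma>(2) \<tau>(2) pf_term)
qed

text \<open>The transposition moves a letter from one pair to another, so only the sign of the
  permutation changes. The remaining pairs contribute a common factor
  \<open>Poly_Mapping.single r e\<close>.\<close>

lemma pfaffian_term_exchange:
  assumes "\<sigma> permutes {1..2 * n}" "i \<in> {1..n}" "j \<in> {1..n}" "i \<noteq> j"
  obtains r and e :: "'k::field" where "e = 1 \<or> e = - 1"
    "pfaffian_term n \<sigma> = generic_skew (\<sigma> (2 * i - 1)) (\<sigma> (2 * i))
      * generic_skew (\<sigma> (2 * j - 1)) (\<sigma> (2 * j)) * Poly_Mapping.single r e"
    "pfaffian_term n (\<sigma> \<circ> transpose (2 * i) (2 * j - 1))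
      = - (generic_skew (\<sigma> (2 * i - 1)) (\<sigma> (2 * j - 1))
      * generic_skew (\<sigma> (2 * i)) (\<sigma> (2 * j)) * Poly_Mapping.single r e)"
proof -
  let ?K = "{1..n} - {i} - {j}" and ?\<tau> = "\<sigma> \<circ> transpose (2 * i) (2 * j - 1)"
  obtain r and e :: 'k where e: "e = 1 \<or> e = - 1"
    "(\<Prod>k\<in>?K. generic_skew (\<sigma> (2 * k - 1)) (\<sigma> (2 * k))) = Poly_Mapping.single r e"
  proof (rule prod_generic_skew[of ?K "\<lambda>k. \<sigma> (2 * k - 1)" "\<lambda>k. \<sigma> (2 * k)", where 'k = 'k])
    show "\<sigma> (2 * k - 1) \<noteq> \<sigma> (2 * k)" if "k \<in> ?K" for k
      using pair_positions_neq[OF assms(1)] that by blast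
  qed (use that in auto)
  have ne: "2 * i \<noteq> 2 * j - 1" "2 * i - 1 \<noteq> 2 * i" "2 * i - 1 \<noteq> 2 * j - 1"
    "2 * j \<noteq> 2 * i" "2 * j \<noteq> 2 * j - 1"
    using assms(2-4) by (auto; presburger)+
  have remove: "(\<Prod>k = 1..n. f k) = f i * f j * (\<Prod>k\<in>?K. f k)" for f :: "nat \<Rightarrow> 'k skew_poly"
    using assms(2-4) by (simp add: prod.remove[of "{1..n}" i] prod.remove[of "{1..n} - {i}" j]
        mult.assoc del: One_nat_def)
  have "(\<Prod>k\<in>?K. generic_skew (?\<tau> (2 * k - 1)) (?\<tau> (2 * k))) = Poly_Mapping.single r e"
  proof -
    have "?\<tau> (2 * k - 1) = \<sigma> (2 * k - 1)" "?\<tau> (2 * k) = \<sigma> (2 * k)" if "k \<in> ?K" for k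
    proof -
      have "2 * k - 1 \<notin> {2 * i, 2 * j - 1}" "2 * k \<notin> {2 * i, 2 * j - 1}"
        using that assms(3) by (auto; presburger)+
      then show "?\<tau> (2 * k - 1) = \<sigma> (2 * k - 1)" "?\<tau> (2 * k) = \<sigma> (2 * k)"
        by (simp_all add: transpose_def)
    qed
    then show ?thesis using e(2) by (metis (no_types, lifting) prod.cong)
  qed
  moreover have "sign ?\<tau> = - sign \<sigma>"
    using assms(1) ne(1) by (subst sign_compose)
      (auto simp: sign_swap_id permutation_swap_id intro: permutation_permutes[THEN iffD2])
  moreover have "?\<tau> (2 * i - 1) = \<sigma> (2 * i - 1)" "?\<tau> (2 * i) = \<sigma> (2 * j - 1)"
    "?\<tau> (2 * j - 1) = \<sigma> (2 * i)" "?\<tau> (2 * j) = \<sigma> (2 * j)"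
    using ne by (simp_all add: transpose_def del: One_nat_def)
  moreover have sgn: "of_int (sign \<sigma>) * Poly_Mapping.single r e
      = Poly_Mapping.single r (of_int (sign \<sigma>) * e)"
    by (metis mult_single single_of_int add_0)
  ultimately show ?thesis
    using e by (intro that[of "of_int (sign \<sigma>) * e" r])
      (auto simp: pfaffian_term_def remove sign_def single_uminus simp del: One_nat_def comp_apply split: if_splits)
qed

lemma pairing_exchange:
  assumes "distinct [a, b, c, d]"
  shows "pairing m (generic_pfaffian n)
      (generic_skew a b * generic_skew c d + generic_skew a c * generic_skew b d) = (0 :: 'k::field)"
proof -
  let ?f = "\<lambda>a b c d. pairing m (generic_pfaffian n) (generic_skew a b * generic_skew c d) :: 'k"
  \<comment> \<open>A nonzero pairing yields a permutation that realises the first matching, and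
    exchanging two of its letters realises the second. Applied to the swapped letters as well, this
    implication shows that one pairing vanishes exactly when the other does.\<close>
  have *: "?f a c b d = - ?f a b c d" if "distinct [a, b, c, d]" "?f a b c d \<noteq> 0" for a b c d
  proof -
    let ?M = "edge a b + edge c d + m"
    have ne: "a \<noteq> b" "c \<noteq> d" "a \<noteq> c" "b \<noteq> d"
      using that(1) by auto
    note dist = that(1)
    obtain e1 where e1: "e1 = 1 \<or> e1 = - 1" "generic_skew a b = Poly_Mapping.single (edge a b) (e1 :: 'k)"
      using generic_skew_edge[OF ne(1)] by blast
    obtain e2 where e2: "e2 = 1 \<or> e2 = - 1" "generic_skew c d = Poly_Mapping.single (edge c d) (e2 :: 'k)"
      using generic_skew_edge[OF ne(2)] by blast
    obtain e3 where e3: "e3 = 1 \<or> e3 = - 1" "generic_skew a c = Poly_Mapping.single (edge a c) (e3 :: 'k)"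
      using generic_skew_edge[OF ne(3)] by blast
    obtain e4 where e4: "e4 = 1 \<or> e4 = - 1" "generic_skew b d = Poly_Mapping.single (edge b d) (e4 :: 'k)"
      using generic_skew_edge[OF ne(4)] by blast
    define s where "s = Poly_Mapping.lookup (generic_pfaffian n :: 'k skew_poly) ?M"
    have f: "?f a b c d = e1 * e2 * s"
      by (simp add: e1(2) e2(2) mult_single pairing_single s_def)
    then have "s \<noteq> 0" using that(2) by auto
    then obtain \<sigma> i j where \<sigma>: "\<sigma> permutes {1..2 * n}" "i \<in> {1..n}" "j \<in> {1..n}" "i \<noteq> j"
      "\<sigma> (2 * i - 1) = a" "\<sigma> (2 * i) = b" "\<sigma> (2 * j - 1) = c" "\<sigma> (2 * j) = d"
      "pfaffian_term n \<sigma> = Poly_Mapping.single ?M s"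
      using pfaffian_matching_permutation[OF _ dist] unfolding s_def by metis
    let ?\<tau> = "\<sigma> \<circ> transpose (2 * i) (2 * j - 1)"
    obtain r and e :: 'k where e: "e = 1 \<or> e = - 1"
      "pfaffian_term n \<sigma> = generic_skew a b * generic_skew c d * Poly_Mapping.single r e"
      "pfaffian_term n ?\<tau> = - (generic_skew a c * generic_skew b d * Poly_Mapping.single r e)"
      using pfaffian_term_exchange[OF \<sigma>(1-4), where 'k = 'k] unfolding \<sigma>(5-8) by metis
    have "Poly_Mapping.single ?M s = Poly_Mapping.single (edge a b + edge c d + r) (e1 * e2 * e)"
      using e(2) \<sigma>(9) by (simp add: e1(2) e2(2) mult_single)
    from single_eq_singleD[OF this \<open>s \<noteq> 0\<close>] have r: "m = r" "s = e1 * e2 * e"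
      by simp_all
    have pf_term: "pfaffian_term n ?\<tau> = Poly_Mapping.single (edge a c + edge b d + m) (- (e3 * e4 * e))"
      using e(3) by (simp add: e3(2) e4(2) mult_single r single_uminus)
    have "?\<tau> permutes {1..2 * n}"
      using \<sigma>(2,3) by (intro permutes_compose[OF permutes_swap_id \<sigma>(1)]) auto
    from lookup_generic_pfaffian[OF this pf_term]
    have "Poly_Mapping.lookup (generic_pfaffian n) (edge a c + edge b d + m) = - (e3 * e4 * e)"
      using e(1) e3(1) e4(1) by auto
    then have "?f a c b d = - (e3 * e4 * (e3 * e4 * e))"
      by (simp add: e3(2) e4(2) mult_single pairing_single)
    \<comment> \<open>The orientation signs \<open>e1\<close> to \<open>e4\<close> square to 1, so
      both sides equal \<open>- e\<close>.\<close>
    also have "\<dots> = - ?f a b c d"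
      unfolding f r(2) using e1(1) e2(1) e3(1) e4(1) by auto
    finally show ?thesis .
  qed
  have swapped: "distinct [a, c, b, d]" using assms by auto
  show ?thesis
  proof (cases "?f a b c d = 0")
    case True
    have "?f a c b d = 0"
    proof (rule ccontr)
      assume nz: "?f a c b d \<noteq> 0"
      from *[OF swapped nz] nz show False
        by (simp only: True neg_0_equal_iff_equal simp_thms)
    qed
    with True show ?thesis by (simp only: pairing_add add_0)
  next
    case False
    from *[OF assms this] show ?thesis by (simp only: pairing_add add.right_inverse)
  qed
qed

section \<open>The apolar ideal\<close>

lemma W_subset_Ann: "W n \<subseteq> Ann n (generic_pfaffian n :: 'k::field skew_poly)"
  unfolding W_def
proof (rule skew.span_minimal)
  show "skew.subspace (Ann n (generic_pfaffian n :: 'k skew_poly))"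
    by (rule skew.subspaceI)
      (auto simp: Ann_iff pairing_add pairing_scale skew_polys_add scale_skew_polys)
  have "W_squares n \<union> W_products n \<union> W_binomials n \<subseteq> (W n :: 'k skew_poly set)"
    unfolding W_def by (rule skew.span_superset)
  then have carrier: "f \<in> skew_polys n"
    if "f \<in> W_squares n \<union> W_products n \<union> W_binomials n" for f :: "'k skew_poly"
    using that W_subset_skew_polys by blast
  have "pairing m (generic_pfaffian n) f = 0"
    if "f \<in> W_squares n \<union> W_products n \<union> W_binomials n" for f :: "'k skew_poly" and m
    using that
  proof (elim UnE)
    assume "f \<in> W_squares n"
    then obtain i j where "i \<in> {1..2 * n}" "j \<in> {1..2 * n}" "f = (generic_skew i j)\<^sup>2"
      by (auto simp: W_squares_def)
    then show ?thesis
      using pairing_not_distinct[of i j i j n m, where 'k = 'k] by (simp add: power2_eq_square)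
  next
    assume "f \<in> W_products n"
    then obtain i j k l where "{i, j, k, l} \<subseteq> {1..2 * n}" "{i, j} \<inter> {k, l} \<noteq> {}"
      "f = generic_skew i j * generic_skew k l"
      unfolding W_products_def by blast
    then show ?thesis
      using pairing_not_distinct[of i j k l n m, where 'k = 'k] by auto
  next
    assume "f \<in> W_binomials n"
    then obtain a b c d where abcd: "a < b" "b < c" "c < d" and
      f: "f \<in> {generic_skew a b * generic_skew c d + generic_skew a c * generic_skew b d,
        generic_skew a b * generic_skew c d - generic_skew a d * generic_skew b c,
        generic_skew a c * generic_skew b d + generic_skew a d * generic_skew b c}"
      unfolding W_binomials_def by blast
    let ?p = "\<lambda>a b c d. pairing m (generic_pfaffian n)
      (generic_skew a b * generic_skew c d) :: 'k"
    have ex: "?p a b c d + ?p a c b d = 0" "?p a b d c + ?p a d b c = 0" "?p a c d b + ?p a d c b = 0"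
      using abcd pairing_exchange[of _ _ _ _ m n, where 'k = 'k] by (simp_all add: pairing_add)
    have sw: "?p a b d c = - ?p a b c d" "?p a c d b = - ?p a c b d" "?p a d c b = - ?p a d b c"
      by (simp_all add: generic_skew_swap[of d c] generic_skew_swap[of d b] generic_skew_swap[of c b]
          pairing_uminus)
    \<comment> \<open>The three matchings of \<open>a\<close>, \<open>b\<close>, \<open>c\<close>,
      \<open>d\<close> have pairings x, -x, x, which is the sign pattern cancelled by the three
      binomials.\<close>
    from ex have "?p a c b d = - ?p a b c d" "?p a d b c = ?p a b c d"
      unfolding sw by (simp_all add: eq_neg_iff_add_eq_0 add.commute)
    then show ?thesis
      using f by (auto simp: pairing_add pairing_diff)
  qed
  then show "W_squares n \<union> W_products n \<union> W_binomials n \<subseteq> Ann n (generic_pfaffian n :: 'k skew_poly)"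
    using carrier unfolding Ann_iff subset_iff by blast
qed

lemma W_ideal_subset_Ann: "W_ideal n \<subseteq> Ann n (generic_pfaffian n)"
  by (rule ring.genideal_minimal[OF cring.axioms(1)[OF cring_skew_ring] ideal_Ann W_subset_Ann])

lemma pfaffian_term_id: "pfaffian_term n id = (skew_word [1..<2 * n + 1] :: 'k::field skew_poly)"
proof -
  have "(\<Prod>i = 1..n. generic_skew (2 * i - 1) (2 * i)) = (skew_word [1..<2 * n + 1] :: 'k skew_poly)"
  proof (induction n)
    case (Suc n)
    have "[1..<2 * Suc n + 1] = [1..<2 * n + 1] @ [2 * n + 1, 2 * n + 2]"
      by simp
    then have "(skew_word [1..<2 * Suc n + 1] :: 'k skew_poly)
      = skew_word [1..<2 * n + 1] * generic_skew (2 * n + 1) (2 * n + 2)"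
      by (simp only: skew_word_append length_upt) (simp add: skew_word_append)
    then show ?case using Suc by simp
  qed simp
  then show ?thesis by (simp add: pfaffian_term_def)
qed

text \<open>The sorted word is the term of the identity; its pairing is the square of its sign.
  Sorting \<open>xs\<close> costs only a sign and an element of the ideal, on which the pairing
  vanishes.\<close>

lemma pairing_skew_word_nonzero:
  assumes "distinct xs" "set xs = {1..2 * n}"
  shows "pairing 0 (generic_pfaffian n) (skew_word xs) \<noteq> (0 :: 'k::field)"
proof -
  let ?ys = "[1..<2 * n + 1]"
  obtain e :: 'k where e: "e = 1 \<or> e = - 1"
    "pfaffian_term n id = Poly_Mapping.single (matching_monom n id) e"
    using pfaffian_term_single[OF permutes_id] by blast
  have "Poly_Mapping.lookup (generic_pfaffian n) (matching_monom n id) = e"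
    using lookup_generic_pfaffian[OF permutes_id e(2)] e(1) by auto
  then have "pairing 0 (generic_pfaffian n) (pfaffian_term n id) \<noteq> (0 :: 'k)"
    using e(1) by (auto simp: pairing_single e(2))
  then have ys: "pairing 0 (generic_pfaffian n) (skew_word ?ys) \<noteq> (0 :: 'k)"
    by (subst pfaffian_term_id[symmetric])
  have "sort xs = ?ys"
    using assms by (intro sorted_distinct_set_unique)
      (simp_all only: sorted_sort distinct_sort set_sort sorted_upt distinct_upt set_upt
        Suc_eq_plus1[symmetric] atLeastLessThanSuc_atLeastAtMost)
  moreover have "length xs = 2 * n"
    using distinct_card[OF assms(1)] assms(2) by simp
  moreover have "eq_upto_sign n (skew_word ([] @ xs)) (skew_word ([] @ sort xs) :: 'k skew_poly)"
    using calculation(2) assms(2) by (intro skew_word_sort) simp_all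
  ultimately have "eq_upto_sign n (skew_word xs) (skew_word ?ys :: 'k skew_poly)"
    by (simp only: append_Nil)
  then have "skew_word xs - skew_word ?ys \<in> Ann n (generic_pfaffian n :: 'k skew_poly)
      \<or> skew_word xs + skew_word ?ys \<in> Ann n (generic_pfaffian n :: 'k skew_poly)"
    using W_ideal_subset_Ann unfolding eq_upto_sign_def by blast
  then have "pairing 0 (generic_pfaffian n) (skew_word xs - skew_word ?ys) = (0 :: 'k)
      \<or> pairing 0 (generic_pfaffian n) (skew_word xs + skew_word ?ys) = (0 :: 'k)"
    unfolding Ann_iff by blast
  then show ?thesis
    using ys by (auto simp: pairing_add pairing_diff)
qed

text \<open>
  Contracting to the monomial of the complement of \<open>T\<close> isolates the coefficient of \<open>T\<close>, because
  every vertex has degree one in a monomial of the Pfaffian.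
\<close>

lemma normal_sum_in_Ann:
  assumes "normal_sum n c \<in> Ann n (generic_pfaffian n :: 'k::field skew_poly)" "T \<in> even_subsets n"
  shows "c T = 0"
proof -
  let ?F = "generic_pfaffian n :: 'k skew_poly" and ?w = "\<lambda>S. skew_word (sorted_list_of_set S) :: 'k skew_poly"
  let ?U = "{1..2 * n} - T"
  have T: "T \<subseteq> {1..2 * n}" "even (card T)" "finite T"
    using assms(2) finite_subset by (auto simp: even_subsets_def)
  have "even (card ?U)"
    using T by (simp add: card_Diff_subset)
  then have U: "even (length (sorted_list_of_set ?U))" "distinct (sorted_list_of_set ?U)"
    by simp_all
  obtain b and e :: 'k where b: "e = 1 \<or> e = - 1" "?w ?U = Poly_Mapping.single b e"
    "\<forall>v. vertex_degree b v = of_bool (v \<in> set (sorted_list_of_set ?U))"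
    by (rule skew_word_distinct[OF U]) (rule that)
  \<comment> \<open>The word of the complement is \<open>e\<close> times the monomial
    \<open>b\<close>, so testing at \<open>b\<close> amounts to multiplying by this word and testing
    at 0.\<close>
  have split: "pairing b ?F (?w S) * e = pairing 0 ?F (?w S * ?w ?U)" for S
    unfolding b(2) mult.commute[of "?w S"] pairing_single_mult by (simp only: add_0_right mult.commute)
  have other: "pairing b ?F (?w S) = 0" if S: "S \<in> even_subsets n" "S \<noteq> T" for S
  proof -
    have S': "S \<subseteq> {1..2 * n}" "even (card S)" "finite S"
      using S finite_subset by (auto simp: even_subsets_def)
    then have ws: "even (length (sorted_list_of_set S))" "distinct (sorted_list_of_set S)"
      by simp_all
    obtain m and d :: 'k where m: "?w S = Poly_Mapping.single m d"
      "\<forall>v. vertex_degree m v = of_bool (v \<in> set (sorted_list_of_set S))"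
      by (rule skew_word_distinct[OF ws]) (rule that)
    \<comment> \<open>The degree is 2 on S - T and 0 on T - S, and one of these sets is
      nonempty.\<close>
    have "\<exists>v\<in>{1..2 * n}. vertex_degree (m + b) v \<noteq> 1"
      using S(2) S'(1) T(1) S'(3) by (auto simp: vertex_degree_add m(2) b(3))
    then have "Poly_Mapping.lookup ?F (m + b) = 0"
      using vertex_degree_generic_pfaffian by blast
    then show ?thesis by (simp add: m(1) pairing_single)
  qed
  have "0 = pairing b ?F (normal_sum n c)"
    using assms(1) by (simp add: Ann_iff)
  also have "\<dots> = (\<Sum>S\<in>even_subsets n. c S * pairing b ?F (?w S))"
    by (simp add: normal_sum_def pairing_sum pairing_scale)
  also have "\<dots> = (\<Sum>S\<in>even_subsets n. if S = T then c T * pairing b ?F (?w T) else 0)"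
    using other by (intro sum.cong) auto
  also have "\<dots> = c T * pairing b ?F (?w T)"
    using assms(2) by simp
  finally have "c T * (pairing b ?F (?w T) * e) = 0"
    by auto
  moreover have "pairing 0 ?F (?w T * ?w ?U) \<noteq> 0"
    using pairing_skew_word_nonzero[of "sorted_list_of_set T @ sorted_list_of_set ?U" n] T
    by (auto simp: skew_word_append)
  ultimately show ?thesis by (simp add: split)
qed

lemma Ann_generic_pfaffian: "Ann n (generic_pfaffian n :: 'k::field skew_poly) = W_ideal n"
proof
  show "W_ideal n \<subseteq> Ann n (generic_pfaffian n :: 'k skew_poly)"
    by (rule W_ideal_subset_Ann)
  show "Ann n (generic_pfaffian n :: 'k skew_poly) \<subseteq> W_ideal n"
  proof
    fix f assume f: "f \<in> Ann n (generic_pfaffian n :: 'k skew_poly)"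
    then obtain c where c: "f - normal_sum n c \<in> W_ideal n"
      using skew_poly_normal_sum unfolding Ann_iff by blast
    \<comment> \<open>The inclusion already proved carries annihilation over from \<open>f\<close>
      to its normal form.\<close>
    then have "f - normal_sum n c \<in> Ann n (generic_pfaffian n :: 'k skew_poly)"
      using W_ideal_subset_Ann by blast
    then have "normal_sum n c \<in> Ann n (generic_pfaffian n :: 'k skew_poly)"
      using f skew_polys_add[OF _ skew_polys_uminus, of f n "f - normal_sum n c"]
      by (simp add: Ann_iff pairing_diff)
    then have "c T = 0" if "T \<in> even_subsets n" for T
      using that by (rule normal_sum_in_Ann)
    then have "normal_sum n c = 0"
      by (simp add: normal_sum_def)
    then show "f \<in> W_ideal n" using c by simp
  qed
qed

theorem theorem4p11:
  fixes n :: nat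
  assumes char: "CHAR('k::field) = 0 \<or> CHAR('k) > 2"
  shows "Ann n (pfaffian n generic_skew :: 'k skew_poly) = Idl\<^bsub>skew_ring n\<^esub> (W n)
    \<and> generated_in_degree n 2 (Ann n (pfaffian n generic_skew :: 'k skew_poly))"
  unfolding generated_in_degree_def using Ann_generic_pfaffian W_subset_degree_two by blast

end
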